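(* Let $k$ be an algebraically closed field and let $A$ be a Frobenius $k$-algebra with Nakayama automorphism $\mathfrak N$. If the order of $\mathfrak N$ is finite and the characteristic of $k$ does not divide the order of $\mathfrak N$, then the BV-algebras $(HH^\bullet(A),\cup,[\ ,\ ],\Delta)$ and $(H^\bullet(A,A_{\mathfrak N}^* ),\cup_*,[\ ,\ ]_*,\overline B_{\mathfrak N})$ are isomorphic.
   Context: Conventions. $\otimes=\otimes_k$; algebras are associative and unital; $(-)^*=\mathrm{Hom}_k(-,k)$. For an $A$-bimodule $M$, $H^\bullet(A,M)$ is Hochschild cohomology, computed by the standard complex $C^n(A,M)=\mathrm{Hom}_k(A^{\otimes n},M)$; $HH^\bullet(A)=H^\bullet(A,A)$. A Frobenius algebra is a finite-dimensional $k$-algebra $A$ with a non-degenerate associative ($\langle ab,c\rangle=\langle a,bc\rangle$) bilinear form $\langle-,-\rangle:A\times A\to k$. Its Nakayama automorphism is the algebra automorphism $\mathfrak N:A\to A$ with $\langle a,-\rangle=\langle-,\mathfrak N(a)\rangle$ for all $a\in A$. $A_{\mathfrak N}$ is the $A$-bimodule with underlying space $A$ and actions $axb=a\,x\,\mathfrak N(b)$ (products in $A$ on the right-hand side). $A_{\mathfrak N}^*$ has the bimodule structure $(afb)(c)=f(bc\,\mathfrak N(a))$. The map $Z:A\to A_{\mathfrak N}^*$, $Z(a)=\langle a,-\rangle$, is an isomorphism of $A$-bimodules. Cup products and brackets. If $M$ is an $A$-bimodule with an associative $k$-algebra structure, $(f\cup g)(a_1\otimes\cdots\otimes a_{n+m})=f(a_1\otimes\cdots\otimes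 a_n)g(a_{n+1}\otimes\cdots\otimes a_{n+m})$. For $f\in C^n(A,M)$, $h\in C^m(A,A)$, $$(f\,\bar\circ\,h)(a_1\otimes\cdots\otimes a_{n+m-1})=\sum_{i=1}^n(-1)^{(i-1)(m-1)}f(a_1\otimes\cdots\otimes a_{i-1}\otimes h(a_i\otimes\cdots\otimes a_{i+m-1})\otimes a_{i+m}\otimes\cdots\otimes a_{n+m-1}).$$ BV-structure on $HH^\bullet(A)$ (known under these hypotheses, due to Volkov): $\cup$ is the cup product for $M=A$; $[f,g]=f\,\bar\circ\,g-(-1)^{(n-1)(m-1)}g\,\bar\circ\,f$; and $\Delta:HH^n(A)\to HH^{n-1}(A)$ is defined by $$\langle\Delta f(a_1\otimes\cdots\otimes a_{n-1}),a_0\rangle=\sum_{i=0}^{n-1}(-1)^{i(n-1)}\langle f(a_i\otimes\cdots\otimes a_{n-1}\otimes a_0\otimes\mathfrak N(a_1)\otimes\cdots\otimes\mathfrak N(a_{i-1})),1\rangle.$$ Structure on $H^\bullet(A,A_{\mathfrak N}^* )$: $A_{\mathfrak N}^*$ carries the multiplication $f\cdot g=Z(Z^{-1}(f)Z^{-1}(g))$, $\cup_*$ is the corresponding cup product, $[f,g]_*=f\,\bar\circ\,(Z^{-1}\circ g)-(-1)^{(n-1)(m-1)}g\,\bar\circ\,(Z^{-1}\circ f)$, and $\overline B_{\mathfrak N}:H^n(A,A_{\mathfrak N}^* )\to H^{n-1}(A,A_{\mathfrak N}^* )$ is $$\overline B_{\mathfrak N}([f])(a_1\otimes\cdots\otimes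 a_{n-1})(a_0)=\sum_{i=0}^{n-1}(-1)^{i(n-1)}f(a_i\otimes\cdots\otimes a_{n-1}\otimes a_0\otimes\mathfrak N(a_1)\otimes\cdots\otimes\mathfrak N(a_{i-1}))(1).$$ A Gerstenhaber algebra is $(\mathcal H^\bullet,\cup,[\ ,\ ])$ with $\mathcal H^\bullet$ a graded $k$-module, $\cup$ a graded commutative associative product of degree $0$, and $[\ ,\ ]:\mathcal H^n\times\mathcal H^m\to\mathcal H^{n+m-1}$ a graded Lie bracket with $[f,g]=-(-1)^{(|f|-1)(|g|-1)}[g,f]$, $[f,[g,h]]=[[f,g],h]+(-1)^{(|f|-1)(|g|-1)}[g,[f,h]]$, $[f,g\cup h]=[f,g]\cup h+(-1)^{(|f|-1)|g|}g\cup[f,h]$. A BV-algebra is a Gerstenhaber algebra with a morphism $\Delta:\mathcal H^{\bullet+1}\to\mathcal H^\bullet$ with $\Delta^2=0$ and $[f,g]=(-1)^{|f|}(\Delta(f\cup g)-\Delta(f)\cup g-(-1)^{|f|}f\cup\Delta(g))$. An isomorphism of BV-algebras is a graded $k$-linear isomorphism compatible with the products, the brackets and the BV-operators.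
   Formalization: Δ and B̄ are computed on N-invariant representatives, and their i=0 term is read as a₀⊗N(a₁)⊗…⊗N(a_{n-1}), since as printed they are ill-defined on classes; as the printed signs break the BV axioms, these are only shown to hold for one structure if and only if for the other. *)

theory Defs
  imports "HOL-Library.Function_Algebras" "HOL-Computational_Algebra.Polynomial"
begin

section \<open>Frobenius algebras\<close>

text \<open>The sort \<open>{ring, monoid_mult}\<close> is that of associative unital rings, the zero ring
  included.\<close>

locale k_algebra = vector_space scale
  for scale :: "'k::field \<Rightarrow> 'a::{ring,monoid_mult} \<Rightarrow> 'a" +
  assumes scale_mult_left: "scale c (x * y) = scale c x * y"
    and scale_mult_right: "scale c (x * y) = x * scale c y"

locale frobenius_algebra = k_algebra scale
  for scale :: "'k::field \<Rightarrow> 'a::{ring,monoid_mult} \<Rightarrow> 'a" +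
  fixes form :: "'a \<Rightarrow> 'a \<Rightarrow> 'k"
  assumes finite_dimensional: "\<exists>B. finite B \<and> module.span scale B = UNIV"
    and form_linear_right: "Vector_Spaces.linear scale (*) (\<lambda>b. form a b)"
    and form_linear_left: "Vector_Spaces.linear scale (*) (\<lambda>a. form a b)"
    and form_assoc: "form (a * b) c = form a (b * c)"
    and form_nondeg_left: "(\<forall>b. form a b = 0) \<Longrightarrow> a = 0"
    and form_nondeg_right: "(\<forall>a. form a b = 0) \<Longrightarrow> b = 0"

definition algebra_automorphism ::
    "('k::field \<Rightarrow> 'a::{ring,monoid_mult} \<Rightarrow> 'a) \<Rightarrow> ('a \<Rightarrow> 'a) \<Rightarrow> bool" where
  "algebra_automorphism scale \<nu> \<longleftrightarrow>
     Vector_Spaces.linear scale scale \<nu> \<and> bij \<nu> \<and> (\<forall>a b. \<nu> (a * b) = \<nu> a * \<nu> b) \<and> \<nu> 1 = 1"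

definition nakayama_automorphism ::
    "('k::field \<Rightarrow> 'a::{ring,monoid_mult} \<Rightarrow> 'a) \<Rightarrow> ('a \<Rightarrow> 'a \<Rightarrow> 'k) \<Rightarrow> ('a \<Rightarrow> 'a) \<Rightarrow> bool" where
  "nakayama_automorphism scale form \<nu> \<longleftrightarrow>
     algebra_automorphism scale \<nu> \<and> (\<forall>a b. form a b = form b (\<nu> a))"

definition has_finite_order :: "('a \<Rightarrow> 'a) \<Rightarrow> bool" where
  "has_finite_order \<nu> \<longleftrightarrow> (\<exists>r>0. \<nu> ^^ r = id)"

definition map_order :: "('a \<Rightarrow> 'a) \<Rightarrow> nat" where
  "map_order \<nu> = (LEAST r. r > 0 \<and> \<nu> ^^ r = id)"

definition frob_iso :: "('a \<Rightarrow> 'a \<Rightarrow> 'k) \<Rightarrow> 'a \<Rightarrow> ('a \<Rightarrow> 'k)" where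
  "frob_iso form a = (\<lambda>b. form a b)"

section \<open>Bimodules and Hochschild cohomology\<close>

record ('k, 'a, 'm) bimodule =
  bcarrier :: "'m set"
  bscale :: "'k \<Rightarrow> 'm \<Rightarrow> 'm"
  lact :: "'a \<Rightarrow> 'm \<Rightarrow> 'm"
  ract :: "'m \<Rightarrow> 'a \<Rightarrow> 'm"

definition regular_bimodule ::
    "('k::field \<Rightarrow> 'a::{ring,monoid_mult} \<Rightarrow> 'a) \<Rightarrow> ('k, 'a, 'a) bimodule" where
  "regular_bimodule scale =
     \<lparr>bcarrier = UNIV, bscale = scale, lact = (\<lambda>a x. a * x), ract = (\<lambda>x b. x * b)\<rparr>"

definition twisted_dual ::
    "('k::field \<Rightarrow> 'a::{ring,monoid_mult} \<Rightarrow> 'a) \<Rightarrow> ('a \<Rightarrow> 'a) \<Rightarrow> ('k, 'a, 'a \<Rightarrow> 'k) bimodule" where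
  "twisted_dual scale \<nu> =
     \<lparr>bcarrier = {\<phi>. Vector_Spaces.linear scale (*) \<phi>},
      bscale = (\<lambda>r \<phi> c. r * \<phi> c),
      lact = (\<lambda>a \<phi> c. \<phi> (c * \<nu> a)),
      ract = (\<lambda>\<phi> b c. \<phi> (b * c))\<rparr>"

text \<open>A linear map on the \<open>n\<close>-fold tensor power of \<open>A\<close> is represented by the corresponding
  \<open>n\<close>-linear map, given as a function on lists that vanishes on all lists of length
  different from \<open>n\<close>.  The degree is an integer; in negative degrees only the zero cochain is
  left, so that the formulas below need no special case at degree \<open>0\<close>.\<close>

definition cochains ::
    "('k::field \<Rightarrow> 'a::{ring,monoid_mult} \<Rightarrow> 'a) \<Rightarrow> ('k, 'a, 'm::ab_group_add) bimodule
      \<Rightarrow> int \<Rightarrow> ('a list \<Rightarrow> 'm) set" where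
  "cochains scale M n = {f.
     (\<forall>xs. f xs \<in> bcarrier M) \<and>
     (\<forall>xs. int (length xs) \<noteq> n \<longrightarrow> f xs = 0) \<and>
     (\<forall>xs x y ys. f (xs @ (x + y) # ys) = f (xs @ x # ys) + f (xs @ y # ys)) \<and>
     (\<forall>xs r x ys. f (xs @ scale r x # ys) = bscale M r (f (xs @ x # ys)))}"

definition hochschild_d ::
    "('k::field, 'a::{ring,monoid_mult}, 'm::ab_group_add) bimodule
      \<Rightarrow> ('a list \<Rightarrow> 'm) \<Rightarrow> ('a list \<Rightarrow> 'm)" where
  "hochschild_d M f xs =
     (if xs = [] then 0 else
        lact M (hd xs) (f (tl xs))
        + (\<Sum>i=1..<length xs.
             bscale M ((-1) ^ i) (f (take (i - 1) xs @ (xs ! (i - 1) * xs ! i) # drop (i + 1) xs)))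
        + bscale M ((-1) ^ length xs) (ract M (f (butlast xs)) (last xs)))"

definition cocycles ::
    "('k::field \<Rightarrow> 'a::{ring,monoid_mult} \<Rightarrow> 'a) \<Rightarrow> ('k, 'a, 'm::ab_group_add) bimodule
      \<Rightarrow> int \<Rightarrow> ('a list \<Rightarrow> 'm) set" where
  "cocycles scale M n = {f \<in> cochains scale M n. hochschild_d M f = 0}"

definition coboundaries ::
    "('k::field \<Rightarrow> 'a::{ring,monoid_mult} \<Rightarrow> 'a) \<Rightarrow> ('k, 'a, 'm::ab_group_add) bimodule
      \<Rightarrow> int \<Rightarrow> ('a list \<Rightarrow> 'm) set" where
  "coboundaries scale M n = hochschild_d M ` cochains scale M (n - 1)"

definition coh_class ::
    "('k::field \<Rightarrow> 'a::{ring,monoid_mult} \<Rightarrow> 'a) \<Rightarrow> ('k, 'a, 'm::ab_group_add) bimodule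
      \<Rightarrow> int \<Rightarrow> ('a list \<Rightarrow> 'm) \<Rightarrow> ('a list \<Rightarrow> 'm) set" where
  "coh_class scale M n f = {g. g - f \<in> coboundaries scale M n}"

definition cohomology ::
    "('k::field \<Rightarrow> 'a::{ring,monoid_mult} \<Rightarrow> 'a) \<Rightarrow> ('k, 'a, 'm::ab_group_add) bimodule
      \<Rightarrow> int \<Rightarrow> ('a list \<Rightarrow> 'm) set set" where
  "cohomology scale M n = coh_class scale M n ` cocycles scale M n"

section \<open>Operations on cochains\<close>

definition cup_cochain ::
    "('m \<Rightarrow> 'm \<Rightarrow> 'm::ab_group_add) \<Rightarrow> int \<Rightarrow> int
      \<Rightarrow> ('a list \<Rightarrow> 'm) \<Rightarrow> ('a list \<Rightarrow> 'm) \<Rightarrow> ('a list \<Rightarrow> 'm)" where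
  "cup_cochain mul n m f g xs =
     (if int (length xs) = n + m then mul (f (take (nat n) xs)) (g (drop (nat n) xs)) else 0)"

definition circ_cochain ::
    "('k::field, 'a::{ring,monoid_mult}, 'm::ab_group_add) bimodule \<Rightarrow> int \<Rightarrow> int
      \<Rightarrow> ('a list \<Rightarrow> 'm) \<Rightarrow> ('a list \<Rightarrow> 'a) \<Rightarrow> ('a list \<Rightarrow> 'm)" where
  "circ_cochain M n m f h xs =
     (if int (length xs) = n + m - 1 then
        (\<Sum>i=1..nat n. bscale M ((-1) powi ((int i - 1) * (m - 1)))
           (f (take (i - 1) xs @ h (take (nat m) (drop (i - 1) xs)) # drop (i - 1 + nat m) xs)))
      else 0)"

text \<open>The parameter \<open>\<zeta>\<close> turns \<open>M\<close>-valued cochains into \<open>A\<close>-valued ones; it is the identity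
  for \<open>M = A\<close> and the inverse of \<open>frob_iso\<close> for the twisted dual.\<close>

definition bracket_cochain ::
    "('k::field, 'a::{ring,monoid_mult}, 'm::ab_group_add) bimodule \<Rightarrow> ('m \<Rightarrow> 'a) \<Rightarrow> int \<Rightarrow> int
      \<Rightarrow> ('a list \<Rightarrow> 'm) \<Rightarrow> ('a list \<Rightarrow> 'm) \<Rightarrow> ('a list \<Rightarrow> 'm)" where
  "bracket_cochain M \<zeta> n m f g xs =
     circ_cochain M n m f (\<zeta> \<circ> g) xs
     - bscale M ((-1) powi ((n - 1) * (m - 1))) (circ_cochain M m n g (\<zeta> \<circ> f) xs)"

text \<open>For \<open>xs = [a\<^sub>1, \<dots>, a\<^sub>n\<^sub>-\<^sub>1]\<close> and \<open>0 < i < n\<close> this is the word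
  \<open>a\<^sub>i, \<dots>, a\<^sub>n\<^sub>-\<^sub>1, a\<^sub>0, \<nu> a\<^sub>1, \<dots>, \<nu> a\<^sub>i\<^sub>-\<^sub>1\<close>.  The index \<open>i = 0\<close> stands cyclically for \<open>i = n\<close>,
  where \<open>a\<^sub>i, \<dots>, a\<^sub>n\<^sub>-\<^sub>1\<close> is empty and the word is \<open>a\<^sub>0, \<nu> a\<^sub>1, \<dots>, \<nu> a\<^sub>n\<^sub>-\<^sub>1\<close>; the sign
  \<open>(-1)\<^sup>i\<^sup>(\<^sup>n\<^sup>-\<^sup>1\<^sup>)\<close> is the same for both.  (With the word \<open>a\<^sub>0, a\<^sub>1, \<dots>, a\<^sub>n\<^sub>-\<^sub>1\<close> instead, the BV
  operator would not preserve cocycles when \<open>\<nu>\<close> is not the identity.)\<close>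

definition bv_word :: "('a \<Rightarrow> 'a) \<Rightarrow> nat \<Rightarrow> 'a \<Rightarrow> 'a list \<Rightarrow> 'a list" where
  "bv_word \<nu> i a0 xs =
     (if i = 0 then a0 # map \<nu> xs else drop (i - 1) xs @ a0 # map \<nu> (take (i - 1) xs))"

definition Delta_cochain ::
    "('a \<Rightarrow> 'a \<Rightarrow> 'k::field) \<Rightarrow> ('a \<Rightarrow> 'a) \<Rightarrow> int
      \<Rightarrow> ('a list \<Rightarrow> 'a::{ring,monoid_mult}) \<Rightarrow> ('a list \<Rightarrow> 'a)" where
  "Delta_cochain form \<nu> n f xs =
     (if int (length xs) = n - 1 then
        (THE b. \<forall>a0. form b a0 =
           (\<Sum>i<nat n. (-1) powi (int i * (n - 1)) * form (f (bv_word \<nu> i a0 xs)) 1))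
      else 0)"

definition B_cochain ::
    "('a \<Rightarrow> 'a) \<Rightarrow> int
      \<Rightarrow> ('a list \<Rightarrow> ('a::{ring,monoid_mult} \<Rightarrow> 'k::field)) \<Rightarrow> ('a list \<Rightarrow> ('a \<Rightarrow> 'k))" where
  "B_cochain \<nu> n f xs =
     (if int (length xs) = n - 1 then
        (\<lambda>a0. \<Sum>i<nat n. (-1) powi (int i * (n - 1)) * f (bv_word \<nu> i a0 xs) 1)
      else 0)"

text \<open>Applied to a cocycle \<open>f\<close>, the formulas for \<open>Delta_cochain\<close> and \<open>B_cochain\<close> give a cochain
  whose Hochschild differential is, up to sign, the difference of \<open>f\<close> and its transform under
  \<open>\<nu>\<close>.  They therefore yield a cocycle exactly if \<open>f\<close> commutes with \<open>\<nu>\<close> in the following sense,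
  and the operators on cohomology are computed on such representatives.  (When the order of \<open>\<nu>\<close>
  is finite and invertible in \<open>k\<close>, averaging over \<open>\<nu>\<close> shows that every class has one.)\<close>

definition nu_invariant :: "('a \<Rightarrow> 'a) \<Rightarrow> ('a list \<Rightarrow> 'a) \<Rightarrow> bool" where
  "nu_invariant \<nu> f \<longleftrightarrow> (\<forall>xs. f (map \<nu> xs) = \<nu> (f xs))"

definition nu_invariant_dual :: "('a \<Rightarrow> 'a) \<Rightarrow> ('a list \<Rightarrow> ('a \<Rightarrow> 'k)) \<Rightarrow> bool" where
  "nu_invariant_dual \<nu> f \<longleftrightarrow> (\<forall>xs c. f (map \<nu> xs) (\<nu> c) = f xs c)"

section \<open>BV-algebras\<close>

text \<open>The underlying data of a BV-algebra: a graded \<open>k\<close>-module with a product, a bracket and an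
  operator of degree \<open>-1\<close>, with explicit degree arguments.\<close>

record ('k, 'h) bv_data =
  comp :: "int \<Rightarrow> 'h set"
  hadd :: "int \<Rightarrow> 'h \<Rightarrow> 'h \<Rightarrow> 'h"
  hzero :: "int \<Rightarrow> 'h"
  hscale :: "int \<Rightarrow> 'k \<Rightarrow> 'h \<Rightarrow> 'h"
  cup :: "int \<Rightarrow> int \<Rightarrow> 'h \<Rightarrow> 'h \<Rightarrow> 'h"
  brk :: "int \<Rightarrow> int \<Rightarrow> 'h \<Rightarrow> 'h \<Rightarrow> 'h"
  bvop :: "int \<Rightarrow> 'h \<Rightarrow> 'h"

definition graded_module :: "('k::field, 'h) bv_data \<Rightarrow> bool" where
  "graded_module X \<longleftrightarrow> (\<forall>n.
     hzero X n \<in> comp X n \<and>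
     (\<forall>f\<in>comp X n. \<forall>g\<in>comp X n. hadd X n f g \<in> comp X n \<and> hadd X n f g = hadd X n g f) \<and>
     (\<forall>r. \<forall>f\<in>comp X n. hscale X n r f \<in> comp X n) \<and>
     (\<forall>f\<in>comp X n. \<forall>g\<in>comp X n. \<forall>h\<in>comp X n.
        hadd X n (hadd X n f g) h = hadd X n f (hadd X n g h)) \<and>
     (\<forall>f\<in>comp X n. hadd X n (hzero X n) f = f \<and>
        hadd X n f (hscale X n (-1) f) = hzero X n \<and> hscale X n 1 f = f) \<and>
     (\<forall>r s. \<forall>f\<in>comp X n.
        hscale X n (r + s) f = hadd X n (hscale X n r f) (hscale X n s f) \<and>
        hscale X n (r * s) f = hscale X n r (hscale X n s f)) \<and>
     (\<forall>r. \<forall>f\<in>comp X n. \<forall>g\<in>comp X n.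
        hscale X n r (hadd X n f g) = hadd X n (hscale X n r f) (hscale X n r g)))"

definition graded_linear ::
    "('k::field, 'h) bv_data \<Rightarrow> int \<Rightarrow> int \<Rightarrow> ('h \<Rightarrow> 'h) \<Rightarrow> bool" where
  "graded_linear X n p T \<longleftrightarrow>
     (\<forall>f\<in>comp X n. T f \<in> comp X p) \<and>
     (\<forall>f\<in>comp X n. \<forall>g\<in>comp X n. T (hadd X n f g) = hadd X p (T f) (T g)) \<and>
     (\<forall>r. \<forall>f\<in>comp X n. T (hscale X n r f) = hscale X p r (T f))"

definition well_formed_data :: "('k::field, 'h) bv_data \<Rightarrow> bool" where
  "well_formed_data X \<longleftrightarrow> graded_module X \<and>
     (\<forall>n m. \<forall>f\<in>comp X n. graded_linear X m (n + m) (\<lambda>g. cup X n m f g)) \<and>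
     (\<forall>n m. \<forall>g\<in>comp X m. graded_linear X n (n + m) (\<lambda>f. cup X n m f g)) \<and>
     (\<forall>n m. \<forall>f\<in>comp X n. graded_linear X m (n + m - 1) (\<lambda>g. brk X n m f g)) \<and>
     (\<forall>n m. \<forall>g\<in>comp X m. graded_linear X n (n + m - 1) (\<lambda>f. brk X n m f g)) \<and>
     (\<forall>n. graded_linear X n (n - 1) (bvop X n))"

text \<open>The axioms below carry the usual signs for a bracket of degree \<open>-1\<close>.  Pitfall: they are
  sensitive to the sign conventions for \<open>\<union>\<close>, the bracket and \<open>\<Delta>\<close>.  For the unsigned cup product
  and the operations defined in the last section, the Leibniz rule and the BV identity hold on
  Hochschild cohomology only up to signs depending on the degrees; for derivations \<open>f\<close>, \<open>g\<close> of a
  commutative \<open>A\<close> and \<open>h \<in> A\<close> one gets \<open>[h, f \<union> g] = -([h, f] \<union> g - f \<union> [h, g])\<close>.\<close>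

definition gerstenhaber_algebra :: "('k::field, 'h) bv_data \<Rightarrow> bool" where
  "gerstenhaber_algebra X \<longleftrightarrow> well_formed_data X \<and>
     (\<forall>n m. \<forall>f\<in>comp X n. \<forall>g\<in>comp X m.
        cup X n m f g = hscale X (n + m) ((-1) powi (n * m)) (cup X m n g f) \<and>
        brk X n m f g = hscale X (n + m - 1) (- ((-1) powi ((n - 1) * (m - 1)))) (brk X m n g f)) \<and>
     (\<forall>n m p. \<forall>f\<in>comp X n. \<forall>g\<in>comp X m. \<forall>h\<in>comp X p.
        cup X (n + m) p (cup X n m f g) h = cup X n (m + p) f (cup X m p g h) \<and>
        brk X n (m + p - 1) f (brk X m p g h) =
          hadd X (n + m + p - 2)
            (brk X (n + m - 1) p (brk X n m f g) h)
            (hscale X (n + m + p - 2) ((-1) powi ((n - 1) * (m - 1)))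
               (brk X m (n + p - 1) g (brk X n p f h))) \<and>
        brk X n (m + p) f (cup X m p g h) =
          hadd X (n + m + p - 1)
            (cup X (n + m - 1) p (brk X n m f g) h)
            (hscale X (n + m + p - 1) ((-1) powi ((n - 1) * m))
               (cup X m (n + p - 1) g (brk X n p f h))))"

definition bv_algebra :: "('k::field, 'h) bv_data \<Rightarrow> bool" where
  "bv_algebra X \<longleftrightarrow> gerstenhaber_algebra X \<and>
     (\<forall>n. \<forall>f\<in>comp X n. bvop X (n - 1) (bvop X n f) = hzero X (n - 2)) \<and>
     (\<forall>n m. \<forall>f\<in>comp X n. \<forall>g\<in>comp X m.
        brk X n m f g =
          hscale X (n + m - 1) ((-1) powi n)
            (hadd X (n + m - 1) (bvop X (n + m) (cup X n m f g))
              (hadd X (n + m - 1)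
                (hscale X (n + m - 1) (-1) (cup X (n - 1) m (bvop X n f) g))
                (hscale X (n + m - 1) (- ((-1) powi n)) (cup X n (m - 1) f (bvop X m g))))))"

definition bv_isomorphism ::
    "('k::field, 'h) bv_data \<Rightarrow> ('k, 'h') bv_data \<Rightarrow> (int \<Rightarrow> 'h \<Rightarrow> 'h') \<Rightarrow> bool" where
  "bv_isomorphism X Y \<phi> \<longleftrightarrow>
     (\<forall>n. bij_betw (\<phi> n) (comp X n) (comp Y n)) \<and>
     (\<forall>n. \<forall>f\<in>comp X n. \<forall>g\<in>comp X n. \<phi> n (hadd X n f g) = hadd Y n (\<phi> n f) (\<phi> n g)) \<and>
     (\<forall>n r. \<forall>f\<in>comp X n. \<phi> n (hscale X n r f) = hscale Y n r (\<phi> n f)) \<and>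
     (\<forall>n m. \<forall>f\<in>comp X n. \<forall>g\<in>comp X m.
        \<phi> (n + m) (cup X n m f g) = cup Y n m (\<phi> n f) (\<phi> m g) \<and>
        \<phi> (n + m - 1) (brk X n m f g) = brk Y n m (\<phi> n f) (\<phi> m g)) \<and>
     (\<forall>n. \<forall>f\<in>comp X n. \<phi> (n - 1) (bvop X n f) = bvop Y n (\<phi> n f))"

section \<open>The two structures on Hochschild cohomology\<close>

text \<open>An operation on classes is the union of the classes of its values on all (for the BV
  operators: all \<open>\<nu>\<close>-invariant) representatives.  Such a union is itself a cohomology class only
  if there is a representative and the class of the value does not depend on it, so
  \<open>well_formed_data\<close> includes well-definedness on cohomology.\<close>

definition HH_data ::
    "('k::field \<Rightarrow> 'a::{ring,monoid_mult} \<Rightarrow> 'a) \<Rightarrow> ('a \<Rightarrow> 'a \<Rightarrow> 'k) \<Rightarrow> ('a \<Rightarrow> 'a)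
      \<Rightarrow> ('k, ('a list \<Rightarrow> 'a) set) bv_data" where
  "HH_data scale form \<nu> =
     (let M = regular_bimodule scale; cl = coh_class scale M in
      \<lparr>comp = cohomology scale M,
       hadd = (\<lambda>n c d. \<Union>f\<in>c. \<Union>g\<in>d. cl n (f + g)),
       hzero = (\<lambda>n. cl n 0),
       hscale = (\<lambda>n r c. \<Union>f\<in>c. cl n (\<lambda>xs. bscale M r (f xs))),
       cup = (\<lambda>n m c d. \<Union>f\<in>c. \<Union>g\<in>d. cl (n + m) (cup_cochain (*) n m f g)),
       brk = (\<lambda>n m c d. \<Union>f\<in>c. \<Union>g\<in>d. cl (n + m - 1) (bracket_cochain M id n m f g)),
       bvop = (\<lambda>n c. \<Union>f\<in>{f\<in>c. nu_invariant \<nu> f}. cl (n - 1) (Delta_cochain form \<nu> n f))\<rparr>)"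

definition twisted_dual_mult :: "('a \<Rightarrow> 'a \<Rightarrow> 'k) \<Rightarrow> ('a \<Rightarrow> 'k) \<Rightarrow> ('a \<Rightarrow> 'k) \<Rightarrow> ('a::times \<Rightarrow> 'k)" where
  "twisted_dual_mult form \<phi> \<psi> =
     frob_iso form (inv (frob_iso form) \<phi> * inv (frob_iso form) \<psi>)"

definition H_twisted_dual_data ::
    "('k::field \<Rightarrow> 'a::{ring,monoid_mult} \<Rightarrow> 'a) \<Rightarrow> ('a \<Rightarrow> 'a \<Rightarrow> 'k) \<Rightarrow> ('a \<Rightarrow> 'a)
      \<Rightarrow> ('k, ('a list \<Rightarrow> ('a \<Rightarrow> 'k)) set) bv_data" where
  "H_twisted_dual_data scale form \<nu> =
     (let M = twisted_dual scale \<nu>; cl = coh_class scale M in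
      \<lparr>comp = cohomology scale M,
       hadd = (\<lambda>n c d. \<Union>f\<in>c. \<Union>g\<in>d. cl n (f + g)),
       hzero = (\<lambda>n. cl n 0),
       hscale = (\<lambda>n r c. \<Union>f\<in>c. cl n (\<lambda>xs. bscale M r (f xs))),
       cup = (\<lambda>n m c d. \<Union>f\<in>c. \<Union>g\<in>d. cl (n + m) (cup_cochain (twisted_dual_mult form) n m f g)),
       brk = (\<lambda>n m c d. \<Union>f\<in>c. \<Union>g\<in>d.
                cl (n + m - 1) (bracket_cochain M (inv (frob_iso form)) n m f g)),
       bvop = (\<lambda>n c. \<Union>f\<in>{f\<in>c. nu_invariant_dual \<nu> f}. cl (n - 1) (B_cochain \<nu> n f))\<rparr>)"

end

theory Submission
  imports Defs
begin

text \<open>The isomorphism is induced by the bimodule isomorphism \<open>Z : A \<rightarrow> A\<^sub>\<nu>\<^sup>*\<close>,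
  \<open>a \<mapsto> \<langle>a, -\<rangle>\<close>.  Composition with \<open>Z\<close> is a bijection between the two Hochschild complexes, and
  it carries the cochain formulas for the product, the bracket and the BV operator on one side to
  those on the other (\<open>D_d_Zc\<close>, \<open>D_cup_Zc\<close>, \<open>D_bracket_Zc\<close>, \<open>D_B_Zc\<close>).  Hence everything that
  holds for one of the two structures holds for the other (\<open>bv_transport\<close>), and the substance of
  the proof is that the operations on \<open>HH\<^sup>\<bullet>(A)\<close> are well defined on cohomology classes
  (\<open>well_formed_HH\<close>).

  For the bracket this is Gerstenhaber's argument.  The signed sum over all insertions of one
  cochain into another is a right pre-Lie product (\<open>circ_circ\<close>), and the Hochschild differential
  is, up to sign, the commutator with the multiplication of \<open>A\<close> (\<open>A_d_eq_circ\<close>).  Formal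
  consequences are \<open>d\<^sup>2 = 0\<close> and the derivation rule for the bracket (\<open>A_d_d\<close>, \<open>A_d_commutator\<close>).
  For the product it is the Leibniz rule \<open>A_d_cup\<close>.

  The BV operator \<open>\<Delta>\<close> does not commute with \<open>d\<close>.  A twisted version of Connes' computation gives
  instead \<open>d \<Delta> + \<Delta> d = T - 1\<close>, where \<open>T f = \<nu>\<^sup>-\<^sup>1 \<circ> f \<circ> \<nu>\<close> (\<open>Delta_homotopy\<close>).  So \<open>T\<close> acts
  trivially on cohomology, and when the order \<open>r\<close> of \<open>\<nu>\<close> is invertible in \<open>k\<close> the mean of
  \<open>f, T f, \<dots>, T\<^sup>r\<^sup>-\<^sup>1 f\<close> is an invariant representative of the class of a cocycle \<open>f\<close>
  (\<open>average_cohomologous\<close>).  On invariant cochains \<open>d\<close> and \<open>\<Delta>\<close> anticommute.  An invariant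
  coboundary is the coboundary of an invariant cochain, again by averaging, and is therefore sent
  to a coboundary (\<open>Delta_invariant_coboundary\<close>).\<close>

section \<open>Insertion of multilinear maps\<close>

text \<open>Signs depend on the parity of an exponent only.  With natural exponents, \<open>m + 1\<close> replaces
  the \<open>m - 1\<close> of the usual formulas, which would be truncated for \<open>m = 0\<close>.\<close>

definition signed :: "nat \<Rightarrow> 'b \<Rightarrow> 'b::ab_group_add" where
  "signed k x = (if even k then x else - x)"

lemma signed_add: "signed k (x + y) = signed k x + signed k y"
  by (simp add: signed_def)

lemma signed_diff: "signed k (x - y) = signed k x - signed k y"
  by (simp add: signed_def)

lemma signed_zero [simp]: "signed k 0 = 0"
  by (simp add: signed_def)

lemma signed_signed: "signed k (signed l x) = signed (k + l) x"
  by (auto simp: signed_def)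

lemma signed_sum: "signed k (sum f I) = (\<Sum>i\<in>I. signed k (f i))"
  by (simp add: signed_def sum_negf)

lemma signed_apply: "signed k f x = signed k (f x)"
  by (simp add: signed_def)

lemma signed_cong: "(even k \<longleftrightarrow> even l) \<Longrightarrow> signed k x = signed l x"
  by (simp add: signed_def)

lemma sum_fun_apply: "sum F I x = (\<Sum>i\<in>I. F i x)"
  by (induction I rule: infinite_finite_induct) auto

text \<open>This is the partial composition \<open>f \<circ>\<^sub>i g\<close> in the endomorphism operad, for \<open>g\<close> of arity
  \<open>m\<close> and with slots numbered from \<open>0\<close>.\<close>

definition insert_at :: "nat \<Rightarrow> nat \<Rightarrow> ('a list \<Rightarrow> 'a) \<Rightarrow> ('a list \<Rightarrow> 'b) \<Rightarrow> 'a list \<Rightarrow> 'b" where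
  "insert_at i m g f xs = f (take i xs @ g (take m (drop i xs)) # drop (i + m) xs)"

lemma split_list_lengths:
  assumes "i + k \<le> length xs"
  obtains us vs ws where "xs = us @ vs @ ws" "length us = i" "length vs = k"
proof
  show "xs = take i xs @ take k (drop i xs) @ drop (i + k) xs"
    by (metis append_take_drop_id drop_drop add.commute)
qed (use assms in auto)

lemma insert_at_append:
  assumes "length us = i" "length vs = m"
  shows "insert_at i m g f (us @ vs @ ws) = f (us @ g vs # ws)"
  using assms by (simp add: insert_at_def)

text \<open>The sequential axiom of an operad: \<open>h\<close> ends up in a slot of \<open>g\<close>.  The bound on the length
  says that both insertions stay inside the word.\<close>

lemma insert_at_nested:
  assumes "i \<le> j" "j < i + m" "i + m + p \<le> length xs + 1"
  shows "insert_at j p h (insert_at i m g f) xs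
       = insert_at i (m + p - 1) (insert_at (j - i) p h g) f xs"
proof -
  obtain us vs ws where 1: "xs = us @ vs @ ws" "length us = i" "length vs = m + p - 1"
    by (rule split_list_lengths[of i "m + p - 1" xs]) (use assms in auto)
  obtain as bs cs where 2: "vs = as @ bs @ cs" "length as = j - i" "length bs = p"
    by (rule split_list_lengths[of "j - i" p vs]) (use assms 1 in auto)
  have "insert_at j p h (insert_at i m g f) ((us @ as) @ bs @ (cs @ ws))
      = insert_at i m g f (us @ (as @ h bs # cs) @ ws)"
    by (subst insert_at_append) (use assms 1 2 in auto)
  also have "\<dots> = f (us @ g (as @ h bs # cs) # ws)"
    by (subst insert_at_append) (use assms 1 2 in auto)
  also have "\<dots> = insert_at i (m + p - 1) (insert_at (j - i) p h g) f (us @ vs @ ws)"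
    by (subst insert_at_append) (use 1 2 in \<open>auto simp: insert_at_append\<close>)
  finally show ?thesis using 1 2 by simp
qed

text \<open>The parallel axiom of an operad: \<open>h\<close> and \<open>g\<close> occupy different slots of \<open>f\<close>, and
  inserting \<open>h\<close> first moves the slot of \<open>g\<close> by \<open>p - 1\<close>.\<close>

lemma insert_at_disjoint:
  assumes "j < i" "i + m + p \<le> length xs + 1"
  shows "insert_at j p h (insert_at i m g f) xs
       = insert_at (i + p - 1) m g (insert_at j p h f) xs"
proof -
  obtain us vs ws where 1: "xs = us @ vs @ ws" "length us = j" "length vs = p"
    by (rule split_list_lengths[of j p xs]) (use assms in auto)
  obtain as bs cs where 2: "ws = as @ bs @ cs" "length as = i - j - 1" "length bs = m"
    by (rule split_list_lengths[of "i - j - 1" m ws]) (use assms 1 in auto)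
  have "insert_at j p h (insert_at i m g f) xs = insert_at i m g f ((us @ h vs # as) @ bs @ cs)"
    using 1 2 by (simp add: insert_at_append)
  also have "\<dots> = f ((us @ h vs # as) @ g bs # cs)"
    by (rule insert_at_append) (use assms 1 2 in auto)
  also have "\<dots> = insert_at j p h f (us @ vs @ (as @ g bs # cs))"
    using 1 2 by (simp add: insert_at_append)
  also have "\<dots> = insert_at (i + p - 1) m g (insert_at j p h f) ((us @ vs @ as) @ bs @ cs)"
    by (subst insert_at_append) (use assms 1 2 in auto)
  finally show ?thesis using 1 2 by simp
qed

definition slot_additive :: "('a::ab_group_add list \<Rightarrow> 'b::ab_group_add) \<Rightarrow> bool" where
  "slot_additive f \<longleftrightarrow> (\<forall>xs x y ys. f (xs @ (x + y) # ys) = f (xs @ x # ys) + f (xs @ y # ys))"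

lemma slot_additiveD: "slot_additive f \<Longrightarrow> f (xs @ (x + y) # ys) = f (xs @ x # ys) + f (xs @ y # ys)"
  by (simp add: slot_additive_def)

lemma slot_additive_zero: "slot_additive f \<Longrightarrow> f (xs @ 0 # ys) = 0"
  using slot_additiveD[of f xs 0 0 ys] by simp

lemma slot_additive_minus: "slot_additive f \<Longrightarrow> f (xs @ (- x) # ys) = - f (xs @ x # ys)"
  using slot_additiveD[of f xs x "-x" ys] slot_additive_zero[of f xs ys]
  by (simp add: eq_neg_iff_add_eq_0 add.commute)

lemma slot_additive_signed: "slot_additive f \<Longrightarrow> f (xs @ signed k x # ys) = signed k (f (xs @ x # ys))"
  by (simp add: signed_def slot_additive_minus)

lemma slot_additive_sum:
  "slot_additive f \<Longrightarrow> f (xs @ sum x I # ys) = (\<Sum>i\<in>I. f (xs @ x i # ys))"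
  by (induction I rule: infinite_finite_induct) (simp_all add: slot_additive_zero slot_additiveD)

text \<open>Gerstenhaber's product of cochains of degrees \<open>n\<close> and \<open>m\<close>.  Testing
  \<open>length xs + 1 = n + m\<close> avoids the degree \<open>n + m - 1\<close>, which is negative for \<open>n = m = 0\<close>.\<close>

definition circ :: "nat \<Rightarrow> nat \<Rightarrow> ('a list \<Rightarrow> 'b::ab_group_add) \<Rightarrow> ('a list \<Rightarrow> 'a) \<Rightarrow> 'a list \<Rightarrow> 'b" where
  "circ n m f g xs =
     (if length xs + 1 = n + m then \<Sum>i<n. signed (i * (m + 1)) (insert_at i m g f xs) else 0)"

lemma circ_zero_left [simp]: "circ n m 0 g = 0"
  by (auto simp: circ_def insert_at_def)

lemma circ_degree_zero [simp]: "circ 0 m f g = 0"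
  by (auto simp: circ_def insert_at_def)

lemma circ_zero_right [simp]: "slot_additive f \<Longrightarrow> circ n m f 0 = 0"
  by (auto simp: circ_def insert_at_def slot_additive_zero)

lemma circ_add_left: "circ n m (f + f') g = circ n m f g + circ n m f' g"
  by (auto simp: circ_def insert_at_def signed_add sum.distrib)

lemma circ_signed_left: "circ n m (signed k f) g = signed k (circ n m f g)"
  using circ_add_left[of n m f "- f" g]
  by (simp add: signed_def eq_neg_iff_add_eq_0 add.commute)

lemma circ_minus_left: "circ n m (- f) g = - circ n m f g"
  using circ_signed_left[of n m 1 f g] by (simp add: signed_def)

lemma circ_diff_left: "circ n m (f - f') g = circ n m f g - circ n m f' g"
  by (auto simp: circ_def insert_at_def signed_diff sum_subtractf)

lemma circ_add_right: "slot_additive f \<Longrightarrow> circ n m f (g + g') = circ n m f g + circ n m f g'"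
  by (auto simp: circ_def insert_at_def signed_add sum.distrib slot_additiveD)

lemma circ_signed_right: "slot_additive f \<Longrightarrow> circ n m f (signed k g) = signed k (circ n m f g)"
  using circ_add_right[of f n m g "- g"]
  by (simp add: signed_def eq_neg_iff_add_eq_0 add.commute)

lemma circ_minus_right: "slot_additive f \<Longrightarrow> circ n m f (- g) = - circ n m f g"
  using circ_signed_right[of f n m 1 g] by (simp add: signed_def)

lemma circ_diff_right: "slot_additive f \<Longrightarrow> circ n m f (g - g') = circ n m f g - circ n m f g'"
  using circ_add_right[of f n m g "-g'"] circ_minus_right[of f n m g'] by simp

text \<open>The part of \<open>(f \<circ> g) \<circ> h\<close> in which \<open>g\<close> and \<open>h\<close> go to different slots of \<open>f\<close>, with
  \<open>h\<close> to the left of \<open>g\<close>.\<close>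

definition disjoint_circ ::
    "nat \<Rightarrow> nat \<Rightarrow> nat \<Rightarrow> ('a list \<Rightarrow> 'b::ab_group_add) \<Rightarrow> ('a list \<Rightarrow> 'a) \<Rightarrow> ('a list \<Rightarrow> 'a)
      \<Rightarrow> 'a list \<Rightarrow> 'b" where
  "disjoint_circ n m p f g h xs =
     (if length xs + 2 = n + m + p
      then \<Sum>i<n. \<Sum>j<i. signed (j * (p + 1) + i * (m + 1)) (insert_at j p h (insert_at i m g f) xs)
      else 0)"

lemma disjoint_circ_degree_le_1: "n \<le> 1 \<Longrightarrow> disjoint_circ n m p f g h = 0"
  by (auto simp: disjoint_circ_def fun_eq_iff le_Suc_eq)

text \<open>Inserting \<open>h\<close> into \<open>f \<circ>\<^sub>i g\<close> hits a slot of \<open>g\<close>, which gives \<open>f \<circ> (g \<circ> h)\<close>, or a slot of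
  \<open>f\<close> to the left or to the right of \<open>g\<close>.  The last two contributions are exchanged, up to sign,
  when \<open>g\<close> and \<open>h\<close> are: the associator is graded symmetric in its last two arguments, which is the
  right pre-Lie identity.\<close>

lemma circ_circ:
  fixes f :: "'a::ab_group_add list \<Rightarrow> 'b::ab_group_add"
  assumes f: "slot_additive f"
  shows "circ (n + m - 1) p (circ n m f g) h
       = circ n (m + p - 1) f (circ m p g h)
         + disjoint_circ n m p f g h + signed ((m + 1) * (p + 1)) (disjoint_circ n p m f h g)"
proof (cases "n = 0 \<or> m = 0 \<and> n = 1")
  case True
  then show ?thesis
    using circ_zero_right[OF f] by (auto simp: disjoint_circ_degree_le_1)
next
  case False
  show ?thesis
  proof (rule ext)
    fix xs :: "'a list"
    show "circ (n + m - 1) p (circ n m f g) h xs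
       = (circ n (m + p - 1) f (circ m p g h)
         + disjoint_circ n m p f g h + signed ((m + 1) * (p + 1)) (disjoint_circ n p m f h g)) xs"
    proof (cases "length xs + 2 = n + m + p")
      case len: True
      let ?I = "\<lambda>i j. insert_at j p h (insert_at i m g f) xs"
      let ?t = "\<lambda>i j. signed (j * (p + 1) + i * (m + 1)) (?I i j)"
      have "circ (n + m - 1) p (circ n m f g) h xs
          = (\<Sum>j<n + m - 1. signed (j * (p + 1)) (insert_at j p h (circ n m f g) xs))"
        using len False by (auto simp: circ_def)
      also have "\<dots> = (\<Sum>j<n + m - 1. \<Sum>i<n. ?t i j)"
      proof (intro sum.cong refl)
        fix j assume "j \<in> {..<n + m - 1}"
        then have "insert_at j p h (circ n m f g) xs = (\<Sum>i<n. signed (i * (m + 1)) (?I i j))"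
          using len False by (simp add: insert_at_def[of j p h] circ_def)
        then show "signed (j * (p + 1)) (insert_at j p h (circ n m f g) xs) = (\<Sum>i<n. ?t i j)"
          by (simp add: signed_sum signed_signed)
      qed
      also have "\<dots> = (\<Sum>i<n. \<Sum>j<n + m - 1. ?t i j)"
        by (rule sum.swap)
      \<comment> \<open>\<open>h\<close> goes to the left of \<open>g\<close>, into \<open>g\<close>, or to the right of \<open>g\<close>\<close>
      also have "\<dots> = (\<Sum>i<n. (\<Sum>j<i. ?t i j) + (\<Sum>j=i..<i + m. ?t i j) + (\<Sum>j=i + m..<n + m - 1. ?t i j))"
      proof (intro sum.cong refl)
        fix i assume i: "i \<in> {..<n}"
        have "(\<Sum>j<n + m - 1. ?t i j) = (\<Sum>j=0..<i + m. ?t i j) + (\<Sum>j=i + m..<n + m - 1. ?t i j)"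
          if "i + m \<le> n + m - 1"
          using that by (simp only: lessThan_atLeast0 sum.atLeastLessThan_concat)
        moreover have "(\<Sum>j=0..<i + m. ?t i j) = (\<Sum>j<i. ?t i j) + (\<Sum>j=i..<i + m. ?t i j)"
          by (simp only: lessThan_atLeast0 sum.atLeastLessThan_concat)
        ultimately show "(\<Sum>j<n + m - 1. ?t i j)
            = (\<Sum>j<i. ?t i j) + (\<Sum>j=i..<i + m. ?t i j) + (\<Sum>j=i + m..<n + m - 1. ?t i j)"
          using i by auto
      qed
      also have "\<dots> = (\<Sum>i<n. \<Sum>j<i. ?t i j) + (\<Sum>i<n. \<Sum>j=i..<i + m. ?t i j)
                     + (\<Sum>i<n. \<Sum>j=i + m..<n + m - 1. ?t i j)"
        by (simp only: sum.distrib)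
      also have "(\<Sum>i<n. \<Sum>j<i. ?t i j) = disjoint_circ n m p f g h xs"
        using len by (simp add: disjoint_circ_def)
      also have "(\<Sum>i<n. \<Sum>j=i..<i + m. ?t i j) = circ n (m + p - 1) f (circ m p g h) xs"
      proof (cases "m + p = 0")
        case True
        then have "circ m p g h = 0" by (auto simp: circ_def)
        then have "circ n (m + p - 1) f (circ m p g h) = 0" using circ_zero_right[OF f] by auto
        then show ?thesis using True by simp
      next
        case mp: False
        have "(\<Sum>i<n. \<Sum>j=i..<i + m. ?t i j)
            = (\<Sum>i<n. signed (i * (m + p)) (insert_at i (m + p - 1) (circ m p g h) f xs))"
        proof (intro sum.cong refl)
          fix i assume i: "i \<in> {..<n}"
          have "(\<Sum>j=i..<i + m. ?t i j) = (\<Sum>k<m. ?t i (k + i))"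
            using sum.shift_bounds_nat_ivl[of "?t i" 0 i m]
            by (simp add: lessThan_atLeast0 add.commute)
          also have "\<dots> = (\<Sum>k<m. signed (i * (m + p)) (signed (k * (p + 1))
                              (insert_at i (m + p - 1) (insert_at k p h g) f xs)))"
          proof (intro sum.cong refl)
            fix k assume "k \<in> {..<m}"
            then show "?t i (k + i) = signed (i * (m + p)) (signed (k * (p + 1))
                (insert_at i (m + p - 1) (insert_at k p h g) f xs))"
              using i len insert_at_nested[of i "k + i" m p xs h g f]
              by (simp add: signed_signed) (rule signed_cong, auto)
          qed
          also have "\<dots> = signed (i * (m + p)) (insert_at i (m + p - 1) (circ m p g h) f xs)"
          proof -
            have "circ m p g h (take (m + p - 1) (drop i xs))
                = (\<Sum>k<m. signed (k * (p + 1)) (insert_at k p h g (take (m + p - 1) (drop i xs))))"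
              using i len mp by (simp add: circ_def)
            then show ?thesis
              unfolding insert_at_def[of i "m + p - 1" _ f]
              by (simp only: slot_additive_sum[OF f] slot_additive_signed[OF f] signed_sum)
          qed
          finally show "(\<Sum>j=i..<i + m. ?t i j) = \<dots>" .
        qed
        moreover have "length xs + 1 = n + (m + p - 1)" "m + p - 1 + 1 = m + p"
          using len mp by auto
        ultimately show ?thesis
          by (simp only: circ_def[of n "m + p - 1" f] simp_thms if_True)
      qed
      also have "(\<Sum>i<n. \<Sum>j=i + m..<n + m - 1. ?t i j)
               = signed ((m + 1) * (p + 1)) (disjoint_circ n p m f h g xs)"
      proof -
        let ?s = "\<lambda>a i. signed (a * (p + 1) + i * (m + 1)) (insert_at i m g (insert_at a p h f) xs)"
        have "(\<Sum>i<n. \<Sum>j=i + m..<n + m - 1. ?t i j)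
            = (\<Sum>i<n. \<Sum>a=Suc i..<n. signed ((m + 1) * (p + 1)) (?s a i))"
        proof (rule sum.cong[OF refl])
          fix i assume i: "i \<in> {..<n}"
          \<comment> \<open>position \<open>a + m - 1\<close> of \<open>f \<circ>\<^sub>i g\<close> is slot \<open>a\<close> of \<open>f\<close>\<close>
          have "(\<Sum>j=i + m..<n + m - 1. ?t i j) = (\<Sum>a=Suc i..<n. ?t i (a + m - 1))"
            by (rule sum.reindex_bij_witness[of _ "\<lambda>a. a + m - 1" "\<lambda>j. j + 1 - m"])
               (use i in \<open>auto\<close>)
          also have "\<dots> = (\<Sum>a=Suc i..<n. signed ((m + 1) * (p + 1)) (?s a i))"
          proof (intro sum.cong refl)
            fix a assume a: "a \<in> {Suc i..<n}"
            then obtain a' where a': "a = Suc a'" by (cases a) auto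
            have "?I i (a + m - 1) = insert_at i m g (insert_at a p h f) xs"
              using insert_at_disjoint[of i a p m xs g h f] a len by simp
            then show "?t i (a + m - 1) = signed ((m + 1) * (p + 1)) (?s a i)"
              by (simp add: signed_signed a') (rule signed_cong, auto)
          qed
          finally show "(\<Sum>j=i + m..<n + m - 1. ?t i j) = \<dots>" .
        qed
        also have "\<dots> = (\<Sum>a<n. \<Sum>i<a. signed ((m + 1) * (p + 1)) (?s a i))"
          unfolding lessThan_atLeast0
          by (simp add: sum.Sigma)
             (rule sum.reindex_bij_witness[of _ "\<lambda>(a,i). (i,a)" "\<lambda>(i,a). (a,i)"], auto)
        also have "\<dots> = signed ((m + 1) * (p + 1)) (disjoint_circ n p m f h g xs)"
          using len by (simp add: disjoint_circ_def signed_sum add_ac)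
        finally show ?thesis .
      qed
      finally show ?thesis
        by (simp add: signed_apply add_ac)
    next
      case len: False
      then show ?thesis
        using False
        by (auto simp: circ_def disjoint_circ_def signed_apply insert_at_def slot_additive_zero[OF f])
    qed
  qed
qed

section \<open>The Hochschild complex of an algebra\<close>

text \<open>Every argument of \<open>insert_at i m g f\<close> reaches \<open>f\<close> either directly or through \<open>g\<close>.
  Additivity and homogeneity of \<open>f\<close> and \<open>g\<close> in each argument are therefore inherited.\<close>

lemma insert_at_slot:
  "(\<exists>us vs. \<forall>x. insert_at i m g f (xs @ x # ys) = f (us @ x # vs)) \<or>
   (\<exists>us as bs vs. \<forall>x. insert_at i m g f (xs @ x # ys) = f (us @ g (as @ x # bs) # vs))"
proof -
  consider "length xs < i" | "i \<le> length xs" "length xs < i + m" | "i + m \<le> length xs" by linarith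
  then show ?thesis
  proof cases
    case 1
    then have "\<forall>x. insert_at i m g f (xs @ x # ys)
        = f (xs @ x # take (i - length xs - 1) ys @ g (take m (drop (i - length xs - 1) ys))
              # drop (i + m - length xs - 1) ys)"
      by (auto simp: insert_at_def take_Cons' drop_Cons')
    then show ?thesis by blast
  next
    case 2
    then have "\<forall>x. insert_at i m g f (xs @ x # ys)
        = f (take i xs @ g (drop i xs @ x # take (m - (length xs - i) - 1) ys)
              # drop (i + m - length xs - 1) ys)"
      by (auto simp: insert_at_def take_Cons' drop_Cons')
    then show ?thesis by blast
  next
    case 3
    then have "\<forall>x. insert_at i m g f (xs @ x # ys)
        = f ((take i xs @ g (take m (drop i xs)) # drop (i + m) xs) @ x # ys)"
      by (auto simp: insert_at_def)
    then show ?thesis by blast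
  qed
qed

definition product_cochain :: "'a::{ring,monoid_mult} list \<Rightarrow> 'a" where
  "product_cochain xs = (if length xs = 2 then xs ! 0 * xs ! 1 else 0)"

text \<open>The two terms are \<open>(x y) z\<close> and \<open>- x (y z)\<close>.\<close>

lemma circ_product_product: "circ 2 2 product_cochain product_cochain = 0"
proof (rule ext)
  fix xs :: "'a list"
  show "circ 2 2 product_cochain product_cochain xs = 0 xs"
  proof (cases "length xs = 3")
    case True
    then obtain x y z where "xs = [x, y, z]"
      by (auto simp: numeral_3_eq_3 length_Suc_conv)
    then show ?thesis
      by (simp add: circ_def numeral_2_eq_2[symmetric] lessThan_Suc insert_at_def product_cochain_def signed_def mult.assoc) (simp add: numeral_2_eq_2 lessThan_Suc mult.assoc)
  qed (simp add: circ_def)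
qed

text \<open>The Gerstenhaber bracket in natural degrees.\<close>

definition commutator :: "nat \<Rightarrow> nat \<Rightarrow> ('a::ab_group_add list \<Rightarrow> 'a) \<Rightarrow> ('a list \<Rightarrow> 'a) \<Rightarrow> 'a list \<Rightarrow> 'a" where
  "commutator n m f g = circ n m f g - signed ((n + 1) * (m + 1)) (circ m n g f)"

definition merge :: "nat \<Rightarrow> 'a::times list \<Rightarrow> 'a list" where
  "merge i xs = take (i - 1) xs @ (xs ! (i - 1) * xs ! i) # drop (i + 1) xs"

lemma length_merge: "0 < i \<Longrightarrow> i < length xs \<Longrightarrow> length (merge i xs) = length xs - 1"
  by (auto simp: merge_def)

lemma merge_append_left: "0 < i \<Longrightarrow> i < length us \<Longrightarrow> merge i (us @ vs) = merge i us @ vs"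
  by (auto simp: merge_def nth_append)

lemma merge_append_right: "0 < i \<Longrightarrow> merge (length us + i) (us @ vs) = us @ merge i vs"
  by (auto simp: merge_def nth_append)

context k_algebra
begin

abbreviation A_cochains :: "int \<Rightarrow> ('a list \<Rightarrow> 'a) set" where
  "A_cochains \<equiv> cochains scale (regular_bimodule scale)"

abbreviation A_d :: "('a list \<Rightarrow> 'a) \<Rightarrow> ('a list \<Rightarrow> 'a)" where
  "A_d \<equiv> hochschild_d (regular_bimodule scale)"

lemma scale_neg_one_power: "scale ((-1) ^ k) x = signed k x"
  by (cases "even k") (auto simp: signed_def)

lemma A_cochains_iff:
  "f \<in> A_cochains n \<longleftrightarrow> (\<forall>xs. int (length xs) \<noteq> n \<longrightarrow> f xs = 0) \<and> slot_additive f \<and>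
     (\<forall>xs r x ys. f (xs @ scale r x # ys) = scale r (f (xs @ x # ys)))"
  by (auto simp: cochains_def regular_bimodule_def slot_additive_def)

lemma A_cochains_additive: "f \<in> A_cochains n \<Longrightarrow> slot_additive f"
  by (simp add: A_cochains_iff)

lemma A_cochains_degree: "f \<in> A_cochains n \<Longrightarrow> int (length xs) \<noteq> n \<Longrightarrow> f xs = 0"
  by (simp add: A_cochains_iff)

lemma A_cochains_homogeneous:
  "f \<in> A_cochains n \<Longrightarrow> f (xs @ scale r x # ys) = scale r (f (xs @ x # ys))"
  by (simp add: A_cochains_iff)

lemma A_cochains_negative: "f \<in> A_cochains n \<Longrightarrow> n < 0 \<Longrightarrow> f = 0"
  by (auto simp: A_cochains_iff)

lemma A_cochains_zero [simp]: "0 \<in> A_cochains n"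
  by (simp add: A_cochains_iff slot_additive_def)

lemma A_cochains_add: "f \<in> A_cochains n \<Longrightarrow> g \<in> A_cochains n \<Longrightarrow> f + g \<in> A_cochains n"
  by (simp add: A_cochains_iff slot_additive_def scale_right_distrib add_ac)

lemma A_cochains_minus: "f \<in> A_cochains n \<Longrightarrow> - f \<in> A_cochains n"
  by (simp add: A_cochains_iff slot_additive_def)

lemma A_cochains_diff: "f \<in> A_cochains n \<Longrightarrow> g \<in> A_cochains n \<Longrightarrow> f - g \<in> A_cochains n"
  using A_cochains_add[of f n "- g"] A_cochains_minus[of g n] by simp

lemma A_cochains_signed: "f \<in> A_cochains n \<Longrightarrow> signed k f \<in> A_cochains n"
  by (simp add: signed_def A_cochains_minus)

lemma A_cochains_sum: "(\<And>i. i \<in> I \<Longrightarrow> F i \<in> A_cochains n) \<Longrightarrow> sum F I \<in> A_cochains n"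
  by (induction I rule: infinite_finite_induct) (simp_all add: A_cochains_add)

lemma A_cochains_scale: "f \<in> A_cochains n \<Longrightarrow> (\<lambda>xs. scale r (f xs)) \<in> A_cochains n"
  by (auto simp: A_cochains_iff slot_additive_def scale_right_distrib scale_left_commute)

lemma product_cochain_in: "(product_cochain :: 'a list \<Rightarrow> 'a) \<in> A_cochains 2"
proof -
  let ?m = "product_cochain :: 'a list \<Rightarrow> 'a"
  have slot: "(\<exists>z. \<forall>x. ?m (xs @ x # ys) = x * z) \<or> (\<exists>z. \<forall>x. ?m (xs @ x # ys) = z * x)
      \<or> (\<forall>x. ?m (xs @ x # ys) = 0)" for xs ys
  proof (cases "length xs + length ys = 1")
    case True
    then have "(\<exists>z. xs = [] \<and> ys = [z]) \<or> (\<exists>z. xs = [z] \<and> ys = [])"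
      by (cases xs; cases ys) auto
    then show ?thesis by (auto simp: product_cochain_def)
  qed (auto simp: product_cochain_def)
  have "?m (xs @ (x + y) # ys) = ?m (xs @ x # ys) + ?m (xs @ y # ys)"
    and "?m (xs @ scale r x # ys) = scale r (?m (xs @ x # ys))" for xs ys x y r
    using slot[of xs ys] by (auto simp: distrib_left distrib_right scale_mult_left[symmetric] scale_mult_right[symmetric])
  then show ?thesis
    unfolding A_cochains_iff slot_additive_def by (auto simp: product_cochain_def)
qed

lemma product_cochain_additive: "slot_additive (product_cochain :: 'a list \<Rightarrow> 'a)"
  using product_cochain_in by (rule A_cochains_additive)

lemma insert_at_cochain:
  assumes f: "f \<in> A_cochains (int n)" and g: "g \<in> A_cochains (int m)" and i: "i < n"
  shows "insert_at i m g f \<in> A_cochains (int n + int m - 1)"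
  unfolding A_cochains_iff slot_additive_def
proof (intro conjI allI impI)
  fix xs :: "'a list" assume "int (length xs) \<noteq> int n + int m - 1"
  then consider "length (take m (drop i xs)) \<noteq> m"
    | "length (take i xs @ g (take m (drop i xs)) # drop (i + m) xs) \<noteq> n"
    using i by fastforce
  then show "insert_at i m g f xs = 0"
  proof cases
    case 1
    then have "g (take m (drop i xs)) = 0" by (intro A_cochains_degree[OF g]) simp
    then show ?thesis by (simp add: insert_at_def slot_additive_zero[OF A_cochains_additive[OF f]])
  next
    case 2
    then show ?thesis unfolding insert_at_def by (intro A_cochains_degree[OF f]) linarith
  qed
next
  fix xs x y ys
  show "insert_at i m g f (xs @ (x + y) # ys)
      = insert_at i m g f (xs @ x # ys) + insert_at i m g f (xs @ y # ys)"
    using insert_at_slot[of i m g f xs ys]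
    by (auto simp: slot_additiveD[OF A_cochains_additive[OF f]] slot_additiveD[OF A_cochains_additive[OF g]])
next
  fix xs r x ys
  show "insert_at i m g f (xs @ scale r x # ys) = scale r (insert_at i m g f (xs @ x # ys))"
    using insert_at_slot[of i m g f xs ys]
    by (auto simp: A_cochains_homogeneous[OF f] A_cochains_homogeneous[OF g])
qed

lemma circ_in:
  assumes f: "f \<in> A_cochains (int n)" and g: "g \<in> A_cochains (int m)"
  shows "circ n m f g \<in> A_cochains (int n + int m - 1)"
proof -
  have in_: "(\<Sum>i<n. signed (i * (m + 1)) (insert_at i m g f)) \<in> A_cochains (int n + int m - 1)"
    by (intro A_cochains_sum A_cochains_signed insert_at_cochain f g) auto
  have "circ n m f g = (\<Sum>i<n. signed (i * (m + 1)) (insert_at i m g f))"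
  proof (rule ext)
    fix xs
    show "circ n m f g xs = (\<Sum>i<n. signed (i * (m + 1)) (insert_at i m g f)) xs"
    proof (cases "length xs + 1 = n + m")
      case True
      then show ?thesis by (simp add: circ_def sum_fun_apply signed_apply)
    next
      case False
      then show ?thesis using A_cochains_degree[OF in_, of xs] by (simp add: circ_def)
    qed
  qed
  then show ?thesis using in_ by simp
qed

lemma A_d_add: "A_d (f + g) = A_d f + A_d g"
  by (rule ext)
     (simp add: hochschild_d_def regular_bimodule_def scale_right_distrib distrib_left distrib_right
        sum.distrib add_ac)

lemma A_d_scale: "A_d (\<lambda>xs. scale r (f xs)) = (\<lambda>xs. scale r (A_d f xs))"
  by (rule ext)
     (simp add: hochschild_d_def regular_bimodule_def scale_right_distrib scale_sum_right
        scale_mult_left[symmetric] scale_mult_right[symmetric] mult.commute)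

lemma A_d_zero [simp]: "A_d 0 = 0"
  using A_d_add[of 0 0] by simp

lemma A_d_minus: "A_d (- f) = - A_d f"
  using A_d_add[of f "- f"] by (simp add: eq_neg_iff_add_eq_0 add.commute)

lemma A_d_diff: "A_d (f - g) = A_d f - A_d g"
  using A_d_add[of f "- g"] by (simp add: A_d_minus)

lemma A_d_signed: "A_d (signed k f) = signed k (A_d f)"
  by (simp add: signed_def A_d_minus)

text \<open>Inserting \<open>f\<close> into the multiplication yields the two outer terms of the differential,
  inserting the multiplication into \<open>f\<close> yields the inner ones.\<close>

lemma A_d_eq_circ:
  assumes f: "f \<in> A_cochains (int n)"
  shows "A_d f = signed (n + 1) (circ 2 n product_cochain f) - circ n 2 f product_cochain"
proof (rule ext)
  fix xs
  show "A_d f xs = (signed (n + 1) (circ 2 n product_cochain f) - circ n 2 f product_cochain) xs"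
  proof (cases "length xs = n + 1")
    case False
    have "A_d f xs = 0"
    proof (cases "xs = []")
      case False
      have *: "f ys = 0" if "length ys + 1 = length xs" for ys
        using that \<open>length xs \<noteq> n + 1\<close> by (intro A_cochains_degree[OF f]) auto
      have **: "(\<Sum>i=1..<length xs. scale ((-1) ^ i)
            (f (take (i - 1) xs @ (xs ! (i - 1) * xs ! i) # drop (i + 1) xs))) = 0"
        by (intro sum.neutral ballI) (subst *, auto)
      show ?thesis
        using False ** *[of "tl xs"] *[of "butlast xs"]
        by (simp add: hochschild_d_def regular_bimodule_def)
    qed (simp add: hochschild_d_def)
    then show ?thesis using False by (simp add: circ_def signed_apply)
  next
    case len: True
    then obtain x xs' where xs: "xs = x # xs'" by (cases xs) auto
    have 1: "circ 2 n product_cochain f xs = f (butlast xs) * last xs + signed (n + 1) (x * f xs')"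
    proof -
      have "drop n xs = [last xs]" "take n xs = butlast xs"
        using len by (metis Suc_eq_plus1 add_diff_cancel_right' append_butlast_last_id
            append_eq_conv_conj length_0_conv length_butlast nat.distinct(1)) (simp add: len butlast_conv_take)
      then show ?thesis
        using len xs by (simp add: circ_def numeral_2_eq_2 insert_at_def product_cochain_def signed_def)
    qed
    have 2: "circ n 2 f product_cochain xs = - (\<Sum>i=1..<n + 1. signed i
        (f (take (i - 1) xs @ (xs ! (i - 1) * xs ! i) # drop (i + 1) xs)))"
    proof -
      have "circ n 2 f product_cochain xs
          = (\<Sum>i<n. signed i (insert_at i 2 product_cochain f xs))"
        using len by (auto simp: circ_def intro!: sum.cong signed_cong)
      also have "\<dots> = (\<Sum>i<n. - signed (Suc i) (f (take i xs @ (xs ! i * xs ! Suc i) # drop (i + 2) xs)))"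
      proof (intro sum.cong refl)
        fix i assume "i \<in> {..<n}"
        then have "product_cochain (take 2 (drop i xs)) = xs ! i * xs ! Suc i"
          using len by (simp add: product_cochain_def)
        then show "signed i (insert_at i 2 product_cochain f xs)
          = - signed (Suc i) (f (take i xs @ (xs ! i * xs ! Suc i) # drop (i + 2) xs))"
          by (simp add: insert_at_def signed_def)
      qed
      also have "\<dots> = - (\<Sum>i=Suc 0..<Suc n. signed i
        (f (take (i - 1) xs @ (xs ! (i - 1) * xs ! i) # drop (i + 1) xs)))"
        by (simp only: sum.shift_bounds_Suc_ivl sum_negf lessThan_atLeast0) simp
      finally show ?thesis by simp
    qed
    show ?thesis
      using 1 2 len xs
      by (simp add: hochschild_d_def regular_bimodule_def scale_neg_one_power signed_apply
          signed_add signed_signed) (simp add: signed_def)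
  qed
qed

lemma A_d_in: assumes "f \<in> A_cochains n" shows "A_d f \<in> A_cochains (n + 1)"
proof (cases "n < 0")
  case True
  then show ?thesis using A_cochains_negative[OF assms] by simp
next
  case False
  then obtain k where k: "n = int k" using nonneg_int_cases by (metis not_less)
  have "signed (k + 1) (circ 2 k product_cochain f) \<in> A_cochains (n + 1)"
    using circ_in[of product_cochain 2 f k] product_cochain_in assms k
    by (intro A_cochains_signed) (simp add: add.commute)
  moreover have "circ k 2 f product_cochain \<in> A_cochains (n + 1)"
    using circ_in[of f k product_cochain 2] product_cochain_in assms k
    by (simp add: add.commute)
  ultimately show ?thesis
    using A_d_eq_circ[of f k] assms k A_cochains_diff by simp
qed

lemma A_d_in_nat: "f \<in> A_cochains (int n) \<Longrightarrow> A_d f \<in> A_cochains (int (n + 1))"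
  using A_d_in[of f "int n"] by (simp add: add.commute)

text \<open>Write \<open>\<mu>\<close> for the multiplication.  By the pre-Lie identity the iterated commutator of
  \<open>\<mu>\<close> with \<open>f\<close> reduces to terms containing \<open>\<mu> \<circ> \<mu> = 0\<close>; the terms in which two factors sit in
  different slots cancel in pairs, also in characteristic \<open>2\<close>.\<close>

lemma A_d_d:
  assumes "f \<in> A_cochains n" shows "A_d (A_d f) = 0"
proof (cases "n < 0")
  case True
  then show ?thesis using A_cochains_negative[OF assms] by simp
next
  case False
  then obtain k where k: "n = int k" using nonneg_int_cases by (metis not_less)
  let ?m = "product_cochain :: 'a list \<Rightarrow> 'a"
  have f: "f \<in> A_cochains (int k)" using assms k by simp
  note add = A_cochains_additive[OF f] product_cochain_additive
  note d = A_d_eq_circ[OF A_d_in_nat[OF f]] A_d_eq_circ[OF f]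
  have 1: "circ 2 (k + 1) ?m (circ 2 k ?m f)
      = - disjoint_circ 2 2 k ?m ?m f - signed (k + 1) (disjoint_circ 2 k 2 ?m f ?m)"
    using circ_circ[OF add(2), of 2 2 k ?m f]
    by (simp add: circ_product_product algebra_simps eq_neg_iff_add_eq_0 signed_def split: if_splits)
  have 2: "circ (k + 1) 2 (circ 2 k ?m f) ?m = circ 2 (k + 1) ?m (circ k 2 f ?m)
      + disjoint_circ 2 k 2 ?m f ?m + signed (k + 1) (disjoint_circ 2 2 k ?m ?m f)"
    using circ_circ[OF add(2), of 2 k 2 f ?m] by (simp add: signed_def)
  have 3: "circ (k + 1) 2 (circ k 2 f ?m) ?m = 0"
    using circ_circ[OF add(1), of k 2 2 ?m ?m]
    by (simp add: circ_product_product circ_zero_right[OF add(1)] signed_def)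
  show ?thesis
    unfolding d(1)
    unfolding d(2) circ_diff_left circ_diff_right[OF add(2)] circ_signed_left
      circ_signed_right[OF add(2)] 1 2 3
    by (cases "even k") (simp_all add: signed_def)
qed

text \<open>The failure of \<open>d\<close> to be a derivation of \<open>\<circ>\<close> is the associator of \<open>\<mu>, f, g\<close>, that is,
  a signed sum of the products of \<open>f\<close> and \<open>g\<close> in both orders; it is graded symmetric in \<open>f\<close> and \<open>g\<close>.\<close>

lemma A_d_circ:
  assumes f: "f \<in> A_cochains (int n)" and g: "g \<in> A_cochains (int m)"
  shows "A_d (circ n m f g) = circ n (m + 1) f (A_d g) + signed (m + 1) (circ (n + 1) m (A_d f) g)
    - signed (n + m) (disjoint_circ 2 n m product_cochain f g
        + signed ((n + 1) * (m + 1)) (disjoint_circ 2 m n product_cochain g f))"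
proof -
  let ?m = "product_cochain :: 'a list \<Rightarrow> 'a"
  note add = A_cochains_additive[OF f] product_cochain_additive
  have 1: "circ (n + 1) m (circ 2 n ?m f) g = circ 2 (n + m - 1) ?m (circ n m f g)
      + disjoint_circ 2 n m ?m f g + signed ((n + 1) * (m + 1)) (disjoint_circ 2 m n ?m g f)"
    using circ_circ[OF add(2), of 2 n m f g] by simp
  show ?thesis
  proof (cases "n + m = 0")
    case True
    then show ?thesis
      using 1 by (simp add: A_d_eq_circ[OF f] signed_def circ_zero_right[OF add(2)] circ_minus_left)
  next
    case False
    have fg: "circ n m f g \<in> A_cochains (int (n + m - 1))"
    proof -
      have "int (n + m - 1) = int n + int m - 1" using False by linarith
      then show ?thesis using circ_in[OF f g] by simp
    qed
    have 2: "circ (n + m - 1) 2 (circ n m f g) ?m = circ n (m + 1) f (circ m 2 g ?m)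
        + disjoint_circ n m 2 f g ?m + signed (m + 1) (disjoint_circ n 2 m f ?m g)"
      using circ_circ[OF add(1), of n m 2 g ?m] by (simp add: signed_def)
    have 3: "circ (n + 1) m (circ n 2 f ?m) g = circ n (m + 1) f (circ 2 m ?m g)
        + disjoint_circ n 2 m f ?m g + signed (m + 1) (disjoint_circ n m 2 f g ?m)"
      using circ_circ[OF add(1), of n 2 m ?m g] by (simp add: signed_def)
    have 4: "signed (n + m - 1 + 1) x = signed (n + m) x" for x :: "'a list \<Rightarrow> 'a"
      using False by simp
    show ?thesis
      unfolding A_d_eq_circ[OF fg] A_d_eq_circ[OF f] A_d_eq_circ[OF g] 4 circ_diff_left
        circ_diff_right[OF add(1)] circ_signed_left circ_signed_right[OF add(1)] 1 2 3
      by (cases "even n"; cases "even m") (simp_all add: signed_def)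
  qed
qed

text \<open>The symmetric defect in \<open>A_d_circ\<close> drops out of the commutator.\<close>

lemma A_d_commutator:
  assumes f: "f \<in> A_cochains (int n)" and g: "g \<in> A_cochains (int m)"
  shows "A_d (commutator n m f g)
       = commutator n (m + 1) f (A_d g) + signed (m + 1) (commutator (n + 1) m (A_d f) g)"
  unfolding commutator_def A_d_diff A_d_signed A_d_circ[OF f g] A_d_circ[OF g f]
  by (cases "even n"; cases "even m") (simp_all add: signed_def algebra_simps)

lemma A_d_apply:
  "xs \<noteq> [] \<Longrightarrow> A_d f xs = hd xs * f (tl xs) + (\<Sum>i=1..<length xs. signed i (f (merge i xs)))
      + signed (length xs) (f (butlast xs) * last xs)"
  by (simp add: hochschild_d_def regular_bimodule_def scale_neg_one_power merge_def)

text \<open>An argument of \<open>f \<union> g\<close> enters exactly one of the two factors.\<close>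

lemma cup_in:
  assumes f: "f \<in> A_cochains n" and g: "g \<in> A_cochains m"
  shows "cup_cochain (*) n m f g \<in> A_cochains (n + m)"
proof (cases "n < 0")
  case True
  then have "cup_cochain (*) n m f g = 0"
    using A_cochains_negative[OF f] by (auto simp: cup_cochain_def)
  then show ?thesis by simp
next
  case False
  have slot: "(\<exists>as bs z. \<forall>x. cup_cochain (*) n m f g (us @ x # vs) = f (as @ x # bs) * z)
    \<or> (\<exists>as bs z. \<forall>x. cup_cochain (*) n m f g (us @ x # vs) = z * g (as @ x # bs))
    \<or> (\<forall>x. cup_cochain (*) n m f g (us @ x # vs) = 0)" for us vs
  proof (cases "int (length us + length vs + 1) = n + m")
    case True
    show ?thesis
    proof (cases "length us < nat n")
      case lt: True
      have "\<forall>x. cup_cochain (*) n m f g (us @ x # vs)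
          = f (us @ x # take (nat n - length us - 1) vs) * g (drop (nat n - length us - 1) vs)"
        using True lt by (simp add: cup_cochain_def take_Cons' drop_Cons')
      then show ?thesis by blast
    next
      case ge: False
      then have "\<forall>x. cup_cochain (*) n m f g (us @ x # vs)
          = f (take (nat n) us) * g (drop (nat n) us @ x # vs)"
        using True by (simp add: cup_cochain_def)
      then show ?thesis by blast
    qed
  qed (simp add: cup_cochain_def)
  have "cup_cochain (*) n m f g (us @ (x + y) # vs)
      = cup_cochain (*) n m f g (us @ x # vs) + cup_cochain (*) n m f g (us @ y # vs)"
    and "cup_cochain (*) n m f g (us @ scale r x # vs)
      = scale r (cup_cochain (*) n m f g (us @ x # vs))" for us vs x y r
    using slot[of us vs]
    by (auto simp: slot_additiveD[OF A_cochains_additive[OF f]] slot_additiveD[OF A_cochains_additive[OF g]]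
        A_cochains_homogeneous[OF f] A_cochains_homogeneous[OF g]
        scale_mult_left[symmetric] scale_mult_right[symmetric] distrib_left distrib_right)
  then show ?thesis
    unfolding A_cochains_iff slot_additive_def by (auto simp: cup_cochain_def)
qed

text \<open>Merging two neighbours inside the first \<open>n + 1\<close> letters concerns \<open>f\<close>, inside the last
  \<open>m + 1\<close> letters \<open>g\<close>.  The last term of \<open>d f\<close> and the first term of \<open>d g\<close> both multiply the
  letter \<open>x\<close> between the two words into the product and cancel.\<close>

lemma A_d_cup:
  assumes f: "f \<in> A_cochains (int n)" and g: "g \<in> A_cochains (int m)"
  shows "A_d (cup_cochain (*) (int n) (int m) f g)
       = cup_cochain (*) (int (n + 1)) (int m) (A_d f) g
         + signed n (cup_cochain (*) (int n) (int (m + 1)) f (A_d g))" (is "A_d ?F = ?R")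
proof (rule ext)
  fix xs
  have R_in: "?R \<in> A_cochains (int n + int m + 1)"
    using cup_in[OF A_d_in_nat[OF f] g] cup_in[OF f A_d_in_nat[OF g]]
    by (intro A_cochains_add A_cochains_signed) (simp_all add: add_ac)
  show "A_d ?F xs = ?R xs"
  proof (cases "length xs = n + m + 1")
    case False
    then have "int (length xs) \<noteq> int n + int m + 1" by linarith
    then show ?thesis
      using A_cochains_degree[OF A_d_in[OF cup_in[OF f g]]] A_cochains_degree[OF R_in] by simp
  next
    case len: True
    define us where "us = take n xs"
    define x where "x = xs ! n"
    define vs where "vs = drop (n + 1) xs"
    have xs: "xs = us @ x # vs" and lus: "length us = n" and lvs: "length vs = m"
      using len by (auto simp: us_def x_def vs_def id_take_nth_drop)
    let ?U = "us @ [x]" and ?V = "x # vs"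
    have F: "?F (as @ bs) = f as * g bs" if "length as = n" "length bs = m" for as bs
      using that by (simp add: cup_cochain_def)
    have "A_d ?F xs = hd xs * ?F (tl xs) + (\<Sum>i=1..<n + m + 1. signed i (?F (merge i xs)))
        + signed (n + m + 1) (?F (butlast xs) * last xs)"
      using len by (subst A_d_apply) auto
    also have "hd xs * ?F (tl xs) = hd ?U * f (tl ?U) * g vs"
    proof -
      have "tl xs = tl ?U @ vs" "hd xs = hd ?U" by (simp_all add: xs tl_append hd_append split: list.split)
      then show ?thesis using F[of "tl ?U" vs] lus lvs by (simp add: mult.assoc)
    qed
    also have "(\<Sum>i=1..<n + m + 1. signed i (?F (merge i xs)))
        = (\<Sum>i=1..<n + 1. signed i (?F (merge i xs))) + (\<Sum>i=n + 1..<n + m + 1. signed i (?F (merge i xs)))"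
      by (rule sum.atLeastLessThan_concat[symmetric]) auto
    also have "(\<Sum>i=1..<n + 1. signed i (?F (merge i xs))) = (\<Sum>i=1..<n + 1. signed i (f (merge i ?U))) * g vs"
      unfolding sum_distrib_right
    proof (intro sum.cong refl)
      fix i assume "i \<in> {1..<n + 1}"
      then have "merge i xs = merge i ?U @ vs" "length (merge i ?U) = n"
        using merge_append_left[of i ?U vs] lus by (simp_all add: xs length_merge)
      then show "signed i (?F (merge i xs)) = signed i (f (merge i ?U)) * g vs"
        using F[of "merge i ?U" vs] lvs by (simp add: signed_def)
    qed
    also have "(\<Sum>i=n + 1..<n + m + 1. signed i (?F (merge i xs)))
        = (\<Sum>k=1..<m + 1. signed (k + n) (?F (merge (k + n) xs)))"
      using sum.shift_bounds_nat_ivl[of "\<lambda>i. signed i (?F (merge i xs))" 1 n "m + 1"]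
      by (simp add: add_ac)
    also have "\<dots> = signed n (f us * (\<Sum>k=1..<m + 1. signed k (g (merge k ?V))))"
      unfolding sum_distrib_left signed_sum
    proof (intro sum.cong refl)
      fix k assume "k \<in> {1..<m + 1}"
      then have "merge (k + n) xs = us @ merge k ?V" "length (merge k ?V) = m"
        using merge_append_right[of k us ?V] lus lvs by (simp_all add: xs length_merge add.commute)
      then show "signed (k + n) (?F (merge (k + n) xs)) = signed n (f us * signed k (g (merge k ?V)))"
        using F[of us "merge k ?V"] lus by (simp add: signed_def)
    qed
    also have "?F (butlast xs) * last xs = f us * (g (butlast ?V) * last ?V)"
    proof -
      have "butlast xs = us @ butlast ?V" "last xs = last ?V" by (simp_all add: xs butlast_append)
      moreover have "length (butlast ?V) = m" unfolding length_butlast using lvs by simp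
      ultimately show ?thesis by (simp only: F[OF lus] mult.assoc)
    qed
    also have "hd ?U * f (tl ?U) * g vs + ((\<Sum>i=1..<n + 1. signed i (f (merge i ?U))) * g vs
          + signed n (f us * (\<Sum>k=1..<m + 1. signed k (g (merge k ?V)))))
        + signed (n + m + 1) (f us * (g (butlast ?V) * last ?V))
        = A_d f ?U * g vs + signed n (f us * A_d g ?V)"
    proof -
      have 1: "A_d f ?U = hd ?U * f (tl ?U) + (\<Sum>i=1..<n + 1. signed i (f (merge i ?U)))
          + signed (n + 1) (f us * x)"
        using A_d_apply[of ?U f] lus by simp
      have 2: "A_d g ?V = x * g vs + (\<Sum>k=1..<m + 1. signed k (g (merge k ?V)))
          + signed (m + 1) (g (butlast ?V) * last ?V)"
        using A_d_apply[of ?V g] lvs by simp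
      show ?thesis
        unfolding 1 2
        by (cases "even n"; cases "even m") (simp_all only: signed_def even_add odd_one if_True if_False
            simp_thms distrib_left distrib_right mult_minus_left mult_minus_right mult.assoc
            add_ac minus_add_distrib minus_minus add.right_inverse add.left_inverse
            minus_add_cancel add_minus_cancel add_0_left add_0_right)
    qed
    also have "\<dots> = ?R xs"
    proof -
      have "xs = ?U @ vs" by (simp add: xs)
      moreover have "nat (1 + int n) - n = 1" by linarith
      ultimately show ?thesis using lus lvs by (simp add: cup_cochain_def signed_apply xs)
    qed
    finally show ?thesis .
  qed
qed

lemma cup_zero_left [simp]: "cup_cochain (*) n m 0 (g :: 'a list \<Rightarrow> 'a) = 0"
  by (auto simp: cup_cochain_def)

lemma cup_zero_right [simp]: "cup_cochain (*) n m (f :: 'a list \<Rightarrow> 'a) 0 = 0"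
  by (auto simp: cup_cochain_def)

lemma A_d_cup_int:
  assumes f: "f \<in> A_cochains n" and g: "g \<in> A_cochains m"
  shows "A_d (cup_cochain (*) n m f g)
       = cup_cochain (*) (n + 1) m (A_d f) g + signed (nat n) (cup_cochain (*) n (m + 1) f (A_d g))"
proof (cases "n < 0 \<or> m < 0")
  case True
  then show ?thesis using A_cochains_negative[OF f] A_cochains_negative[OF g] by auto
next
  case False
  then obtain i j where "n = int i" "m = int j" using nonneg_int_cases by (metis not_less)
  then show ?thesis using A_d_cup[of f i g j] f g by (simp add: add.commute)
qed

lemma commutator_in:
  assumes "f \<in> A_cochains (int n)" "g \<in> A_cochains (int m)"
  shows "commutator n m f g \<in> A_cochains (int n + int m - 1)"
  using circ_in[OF assms] circ_in[OF assms(2,1)]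
  by (simp add: commutator_def A_cochains_diff A_cochains_signed add.commute)

lemma neg_one_powi: "scale ((-1) powi k) x = (if even k then x else - x)"
  by (simp add: power_int_minus_left)

lemma circ_cochain_eq_circ:
  assumes f: "f \<in> A_cochains n" and g: "g \<in> A_cochains m"
  shows "circ_cochain (regular_bimodule scale) n m f g = circ (nat n) (nat m) f g"
proof (cases "n < 0 \<or> m < 0")
  case True
  then consider "f = 0" | "g = 0"
    using A_cochains_negative[OF f] A_cochains_negative[OF g] by auto
  then show ?thesis
  proof cases
    case 1
    then show ?thesis by (auto simp: circ_cochain_def regular_bimodule_def)
  next
    case 2
    then show ?thesis
      by (auto simp: circ_cochain_def regular_bimodule_def A_cochains_additive[OF f]
          slot_additive_zero[OF A_cochains_additive[OF f]])
  qed
next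
  case False
  then obtain i j where nm: "n = int i" "m = int j" using nonneg_int_cases by (metis not_less)
  have "(\<Sum>k=1..i. scale ((-1) powi ((int k - 1) * (int j - 1)))
           (f (take (k - 1) xs @ g (take j (drop (k - 1) xs)) # drop (k - 1 + j) xs)))
      = (\<Sum>k<i. signed (k * (j + 1)) (insert_at k j g f xs))" for xs
    by (rule sum.reindex_bij_witness[of _ Suc "\<lambda>k. k - 1"])
       (auto simp: neg_one_powi insert_at_def signed_def of_nat_diff)
  moreover have "int (length xs) = int i + int j - 1 \<longleftrightarrow> length xs + 1 = i + j" for xs :: "'a list"
    by linarith
  ultimately show ?thesis
    unfolding nm by (auto simp: fun_eq_iff circ_cochain_def regular_bimodule_def circ_def)
qed

abbreviation A_bracket :: "int \<Rightarrow> int \<Rightarrow> ('a list \<Rightarrow> 'a) \<Rightarrow> ('a list \<Rightarrow> 'a) \<Rightarrow> 'a list \<Rightarrow> 'a" where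
  "A_bracket \<equiv> bracket_cochain (regular_bimodule scale) id"

lemma commutator_zero_left [simp]: "slot_additive g \<Longrightarrow> commutator n m 0 g = 0"
  by (simp add: commutator_def)

lemma commutator_zero_right [simp]: "slot_additive f \<Longrightarrow> commutator n m f 0 = 0"
  by (simp add: commutator_def)

lemma bracket_eq_commutator:
  assumes f: "f \<in> A_cochains n" and g: "g \<in> A_cochains m"
  shows "A_bracket n m f g = commutator (nat n) (nat m) f g"
proof (cases "n < 0 \<or> m < 0")
  case True
  then have "f = 0 \<or> g = 0"
    using A_cochains_negative[OF f] A_cochains_negative[OF g] by auto
  moreover have "A_bracket n m f g xs = 0" if "f = 0 \<or> g = 0" for xs
    using that A_cochains_additive[OF f] A_cochains_additive[OF g]
    by (auto simp: bracket_cochain_def circ_cochain_eq_circ[OF f g] circ_cochain_eq_circ[OF g f])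
       (auto simp: regular_bimodule_def)
  ultimately show ?thesis
    using A_cochains_additive[OF f] A_cochains_additive[OF g] by auto
next
  case False
  then obtain i j where nm: "n = int i" "m = int j" using nonneg_int_cases by (metis not_less)
  have "scale ((-1) powi ((int i - 1) * (int j - 1))) x = signed ((i + 1) * (j + 1)) x" for x
    by (auto simp: neg_one_powi signed_def)
  then show ?thesis
    using circ_cochain_eq_circ[OF f g] circ_cochain_eq_circ[OF g f]
    unfolding nm by (auto simp: fun_eq_iff bracket_cochain_def commutator_def signed_apply regular_bimodule_def)
qed

lemma bracket_in:
  assumes f: "f \<in> A_cochains n" and g: "g \<in> A_cochains m"
  shows "A_bracket n m f g \<in> A_cochains (n + m - 1)"
proof (cases "n < 0 \<or> m < 0")
  case True
  then have "f = 0 \<or> g = 0" using A_cochains_negative[OF f] A_cochains_negative[OF g] by auto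
  then show ?thesis
    using A_cochains_additive[OF f] A_cochains_additive[OF g] bracket_eq_commutator[OF f g] by auto
next
  case False
  then obtain i j where "n = int i" "m = int j" using nonneg_int_cases by (metis not_less)
  then show ?thesis using commutator_in[of f i g j] f g bracket_eq_commutator[OF f g] by simp
qed

lemma A_d_bracket:
  assumes f: "f \<in> A_cochains n" and g: "g \<in> A_cochains m"
  shows "A_d (A_bracket n m f g)
       = A_bracket n (m + 1) f (A_d g) + signed (nat m + 1) (A_bracket (n + 1) m (A_d f) g)"
proof (cases "n < 0 \<or> m < 0")
  case True
  then have "f = 0 \<or> g = 0" using A_cochains_negative[OF f] A_cochains_negative[OF g] by auto
  then show ?thesis
    using A_cochains_additive[OF f] A_cochains_additive[OF g] A_cochains_additive[OF A_d_in[OF f]]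
      A_cochains_additive[OF A_d_in[OF g]]
    by (auto simp: bracket_eq_commutator[OF f g] bracket_eq_commutator[OF f A_d_in[OF g]]
      bracket_eq_commutator[OF A_d_in[OF f] g])
next
  case False
  then obtain i j where nm: "n = int i" "m = int j" using nonneg_int_cases by (metis not_less)
  have *: "nat (int k + 1) = k + 1" for k by linarith
  show ?thesis
    using A_d_commutator[of f i g j] f g
    unfolding bracket_eq_commutator[OF f g] bracket_eq_commutator[OF f A_d_in[OF g]]
      bracket_eq_commutator[OF A_d_in[OF f] g]
    by (simp only: nm nat_int *)
qed

end

section \<open>Twisted cyclic rotations\<close>

text \<open>The generator of the cyclic action on words, twisted by \<open>\<nu>\<close>.\<close>

definition rotate_tw :: "('a \<Rightarrow> 'a) \<Rightarrow> 'a list \<Rightarrow> 'a list" where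
  "rotate_tw \<nu> xs = tl xs @ [\<nu> (hd xs)]"

text \<open>Face \<open>0\<close> is the wrap-around product of the last letter with the twisted first one.  A
  cochain \<open>f\<close> is viewed as the function of \<open>a\<^sub>1, \<dots>, a\<^sub>n, a\<^sub>0\<close> with value
  \<open>\<langle>f(a\<^sub>1, \<dots>, a\<^sub>n), a\<^sub>0\<rangle>\<close>; because \<open>\<langle>a x, b\<rangle> = \<langle>x, b \<nu>(a)\<rangle>\<close>, its differential is then the
  alternating sum over all faces.\<close>

definition cyclic_face :: "('a::times \<Rightarrow> 'a) \<Rightarrow> nat \<Rightarrow> 'a list \<Rightarrow> 'a list" where
  "cyclic_face \<nu> i xs = (if i = 0 then merge (length xs - 1) (rotate_tw \<nu> xs) else merge i xs)"

lemma length_rotate_tw [simp]: "xs \<noteq> [] \<Longrightarrow> length (rotate_tw \<nu> xs) = length xs"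
  by (simp add: rotate_tw_def)

lemma rotate_tw_power:
  "j \<le> length xs \<Longrightarrow> (rotate_tw \<nu> ^^ j) xs = drop j xs @ map \<nu> (take j xs)"
proof (induction j)
  case (Suc j)
  then have "drop j xs = xs ! j # drop (Suc j) xs" by (simp add: Cons_nth_drop_Suc)
  then show ?case using Suc by (simp add: rotate_tw_def take_Suc_conv_app_nth)
qed simp

lemma length_rotate_tw_power [simp]: "length ((rotate_tw \<nu> ^^ j) xs) = length xs" if "xs \<noteq> []"
proof (induction j)
  case (Suc j)
  then show ?case using that by (auto simp: rotate_tw_def simp flip: length_greater_0_conv)
qed simp

lemma length_cyclic_face: "i < length xs \<Longrightarrow> 1 < length xs \<Longrightarrow> length (cyclic_face \<nu> i xs) = length xs - 1"
  by (cases "xs = []") (auto simp: cyclic_face_def length_merge)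

lemma merge_Cons: "0 < i \<Longrightarrow> merge (Suc i) (x # xs) = x # merge i xs"
  by (cases i) (auto simp: merge_def)

lemma merge_last: "merge (Suc (length xs)) (xs @ [x, y]) = xs @ [x * y]"
  by (simp add: merge_def nth_append)

text \<open>For \<open>i = 0\<close> both sides end in \<open>\<nu>(x y) = \<nu>(x) \<nu>(y)\<close>, where \<open>x, y\<close> are the first two
  letters; otherwise the merged letters are only shifted by one place.\<close>

lemma rotate_tw_cyclic_face:
  assumes mult: "\<And>a b. \<nu> (a * b) = \<nu> a * \<nu> b" and i: "Suc i < length xs"
  shows "rotate_tw \<nu> (cyclic_face \<nu> (Suc i) xs) = cyclic_face \<nu> i (rotate_tw \<nu> xs)"
proof -
  obtain x y zs where xs: "xs = x # y # zs"
    using i by (cases xs; cases "tl xs") auto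
  show ?thesis
  proof (cases i)
    case 0
    then show ?thesis
      using merge_last[of zs "\<nu> x" "\<nu> y"]
      by (simp add: xs cyclic_face_def rotate_tw_def mult) (simp add: merge_def mult)
  next
    case (Suc j)
    have "cyclic_face \<nu> (Suc i) xs = x # merge i (y # zs)"
      using Suc by (simp add: cyclic_face_def xs merge_Cons)
    moreover have "merge i (y # zs @ [\<nu> x]) = merge i (y # zs) @ [\<nu> x]"
      using merge_append_left[of i "y # zs" "[\<nu> x]"] i Suc by (simp add: xs)
    ultimately show ?thesis
      using Suc by (simp add: xs rotate_tw_def cyclic_face_def)
  qed
qed

lemma rotate_tw_power_face_le:
  assumes mult: "\<And>a b. \<nu> (a * b) = \<nu> a * \<nu> b"
  shows "j \<le> i \<Longrightarrow> i < length xs \<Longrightarrow>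
    (rotate_tw \<nu> ^^ j) (cyclic_face \<nu> i xs) = cyclic_face \<nu> (i - j) ((rotate_tw \<nu> ^^ j) xs)"
proof (induction j)
  case (Suc j)
  have "xs \<noteq> []" using Suc by auto
  then show ?case
    using Suc rotate_tw_cyclic_face[of \<nu> "i - Suc j" "(rotate_tw \<nu> ^^ j) xs", OF mult]
    by (simp add: Suc_diff_Suc)
qed simp

text \<open>After \<open>i\<close> rotations the merged letter is at the wrap-around position, and face \<open>0\<close> of a
  word of \<open>n + 1\<close> letters is face \<open>n\<close> of its rotation.\<close>

lemma rotate_tw_power_face_ge:
  assumes mult: "\<And>a b. \<nu> (a * b) = \<nu> a * \<nu> b"
    and len: "length xs = n + 1" and ij: "i \<le> j" "j < n"
  shows "(rotate_tw \<nu> ^^ j) (cyclic_face \<nu> i xs)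
       = cyclic_face \<nu> (n - j + i) ((rotate_tw \<nu> ^^ (j + 1)) xs)"
proof -
  let ?R = "rotate_tw \<nu>"
  have ne: "xs \<noteq> []" using len by auto
  have "(?R ^^ j) (cyclic_face \<nu> i xs) = (?R ^^ (j - i)) ((?R ^^ i) (cyclic_face \<nu> i xs))"
    using ij by (simp flip: funpow_add o_apply[of "?R ^^ (j - i)"])
  also have "(?R ^^ i) (cyclic_face \<nu> i xs) = cyclic_face \<nu> 0 ((?R ^^ i) xs)"
    using rotate_tw_power_face_le[OF mult, of i i xs] ij len by simp
  also have "\<dots> = cyclic_face \<nu> n ((?R ^^ (i + 1)) xs)"
    using len ij ne by (simp add: cyclic_face_def)
  also have "(?R ^^ (j - i)) \<dots> = cyclic_face \<nu> (n - (j - i)) ((?R ^^ (j - i)) ((?R ^^ (i + 1)) xs))"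
    by (rule rotate_tw_power_face_le[OF mult]) (use len ij ne in \<open>simp_all del: funpow.simps\<close>)
  also have "(?R ^^ (j - i)) ((?R ^^ (i + 1)) xs) = (?R ^^ (j - i + (i + 1))) xs"
    by (simp only: funpow_add o_apply)
  also have "j - i + (i + 1) = j + 1" using ij by simp
  also have "n - (j - i) = n - j + i" using ij by simp
  finally show ?thesis .
qed

text \<open>A one-letter word belongs to a cochain of degree \<open>0\<close>, which is not a differential of
  anything; hence the value \<open>0\<close> there.\<close>

definition cyclic_d :: "('a::times \<Rightarrow> 'a) \<Rightarrow> ('a list \<Rightarrow> 'b::ab_group_add) \<Rightarrow> 'a list \<Rightarrow> 'b" where
  "cyclic_d \<nu> \<psi> xs = (if length xs \<le> 1 then 0 else \<Sum>i<length xs. signed i (\<psi> (cyclic_face \<nu> i xs)))"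

text \<open>The reduced operator \<open>s N\<close> of Connes, with \<open>N\<close> the signed norm of the twisted rotation and
  \<open>s\<close> the insertion of \<open>1\<close> in the last place.\<close>

definition cyclic_B :: "('a::one \<Rightarrow> 'a) \<Rightarrow> ('a list \<Rightarrow> 'b::ab_group_add) \<Rightarrow> 'a list \<Rightarrow> 'b" where
  "cyclic_B \<nu> \<psi> xs =
     (\<Sum>j<length xs. signed ((j + 1) * (length xs + 1)) (\<psi> ((rotate_tw \<nu> ^^ j) xs @ [1])))"

text \<open>The two faces that involve the letter \<open>1\<close> only remove it: one leaves the word as it is,
  the other one leaves its rotation.\<close>

lemma cyclic_d_append_one:
  fixes \<nu> :: "'a::monoid_mult \<Rightarrow> 'a"
  assumes len: "length xs = n + 1"
  shows "cyclic_d \<nu> \<psi> (xs @ [1]) = \<psi> (rotate_tw \<nu> xs)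
    + (\<Sum>i=1..n. signed i (\<psi> (cyclic_face \<nu> i xs @ [1]))) + signed (n + 1) (\<psi> xs)"
proof -
  have "cyclic_d \<nu> \<psi> (xs @ [1]) = (\<Sum>i<n + 2. signed i (\<psi> (cyclic_face \<nu> i (xs @ [1]))))"
    using len by (simp add: cyclic_d_def)
  also have "\<dots> = \<psi> (cyclic_face \<nu> 0 (xs @ [1]))
      + (\<Sum>i=1..n. signed i (\<psi> (cyclic_face \<nu> i (xs @ [1]))))
      + signed (n + 1) (\<psi> (cyclic_face \<nu> (n + 1) (xs @ [1])))"
  proof -
    have "{..<n + 2} = insert 0 (insert (n + 1) {1..n})" by auto
    then show ?thesis by (simp add: signed_def add_ac)
  qed
  also have "cyclic_face \<nu> 0 (xs @ [1]) = rotate_tw \<nu> xs"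
  proof -
    obtain x zs where xs: "xs = x # zs" using len by (cases xs) auto
    show ?thesis using merge_last[of zs 1 "\<nu> x"] by (simp add: xs cyclic_face_def rotate_tw_def)
  qed
  also have "cyclic_face \<nu> (n + 1) (xs @ [1]) = xs"
  proof -
    obtain zs z where xs: "xs = zs @ [z]" using len by (cases xs rule: rev_cases) auto
    show ?thesis using merge_last[of zs z 1] len by (simp add: xs cyclic_face_def)
  qed
  also have "(\<Sum>i=1..n. signed i (\<psi> (cyclic_face \<nu> i (xs @ [1]))))
      = (\<Sum>i=1..n. signed i (\<psi> (cyclic_face \<nu> i xs @ [1])))"
    by (intro sum.cong refl) (use len in \<open>simp add: cyclic_face_def merge_append_left\<close>)
  finally show ?thesis .
qed

text \<open>In \<open>d B\<close> faces come before rotations, in \<open>B d\<close> after them.  Commuting the two matches all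
  terms in which proper letters are merged, with opposite signs.  What is left over are the two
  faces of \<open>B d\<close> that remove the letter \<open>1\<close>; summed over all rotations they telescope to the full
  rotation, which applies \<open>\<nu>\<close> to every letter, minus the identity.\<close>

lemma cyclic_homotopy:
  fixes \<nu> :: "'a::monoid_mult \<Rightarrow> 'a" and \<psi> :: "'a list \<Rightarrow> 'b::ab_group_add"
  assumes mult: "\<And>a b. \<nu> (a * b) = \<nu> a * \<nu> b" and ne: "xs \<noteq> []"
  shows "cyclic_d \<nu> (cyclic_B \<nu> \<psi>) xs + cyclic_B \<nu> (cyclic_d \<nu> \<psi>) xs = \<psi> (map \<nu> xs) - \<psi> xs"
proof -
  obtain n where len: "length xs = n + 1" using ne by (cases xs) auto
  let ?R = "rotate_tw \<nu>"
  define \<chi> where "\<chi> ys = \<psi> (ys @ [1])" for ys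
  have "cyclic_d \<nu> (cyclic_B \<nu> \<psi>) xs
      = (\<Sum>i<n + 1. \<Sum>j<n. signed (i + (j + 1) * (n + 1)) (\<chi> ((?R ^^ j) (cyclic_face \<nu> i xs))))"
  proof (cases "n = 0")
    case True
    then show ?thesis using len by (simp add: cyclic_d_def)
  next
    case False
    have "cyclic_B \<nu> \<psi> (cyclic_face \<nu> i xs)
        = (\<Sum>j<n. signed ((j + 1) * (n + 1)) (\<chi> ((?R ^^ j) (cyclic_face \<nu> i xs))))" if "i < n + 1" for i
      using length_cyclic_face[of i xs \<nu>] that len False by (simp add: cyclic_B_def \<chi>_def)
    then show ?thesis
      using len False by (simp add: cyclic_d_def signed_sum signed_signed)
  qed
  also have "\<dots> = (\<Sum>(i, j)\<in>{..<n + 1} \<times> {..<n}. signed (i + (j + 1) * (n + 1)) (\<chi> ((?R ^^ j) (cyclic_face \<nu> i xs))))"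
    by (simp add: sum.cartesian_product)
  also have "\<dots> = (\<Sum>(j, i)\<in>{..<n + 1} \<times> {1..n}. - signed (i + (j + 1) * n) (\<chi> (cyclic_face \<nu> i ((?R ^^ j) xs))))"
    \<comment> \<open>the two cases are \<open>rotate_tw_power_face_le\<close> and \<open>rotate_tw_power_face_ge\<close>\<close>
  proof (rule sum.reindex_bij_witness[where
        j = "\<lambda>(i, j). if j < i then (j, i - j) else (j + 1, n - j + i)" and
        i = "\<lambda>(j, i). if i + j \<le> n then (i + j, j) else (i + j - 1 - n, j - 1)"])
    fix ij assume "ij \<in> {..<n + 1} \<times> {..<n}"
    then obtain i j where ij: "ij = (i, j)" "i \<le> n" "j < n" by auto
    show "(case (case ij of (i, j) \<Rightarrow> if j < i then (j, i - j) else (j + 1, n - j + i)) of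
             (j, i) \<Rightarrow> - signed (i + (j + 1) * n) (\<chi> (cyclic_face \<nu> i ((?R ^^ j) xs))))
        = (case ij of (i, j) \<Rightarrow> signed (i + (j + 1) * (n + 1)) (\<chi> ((?R ^^ j) (cyclic_face \<nu> i xs))))"
    proof (cases "j < i")
      case True
      then show ?thesis
        using ij len rotate_tw_power_face_le[OF mult, of j i xs] by (auto simp: signed_def)
    next
      case False
      then show ?thesis
        using ij len rotate_tw_power_face_ge[OF mult, of xs n i j]
        by (auto simp: signed_def simp del: funpow.simps)
    qed
  qed auto
  also have "\<dots> = - (\<Sum>j<n + 1. \<Sum>i=1..n. signed (i + (j + 1) * n) (\<chi> (cyclic_face \<nu> i ((?R ^^ j) xs))))"
    by (simp add: sum.cartesian_product sum_negf case_prod_unfold)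
  finally have 1: "cyclic_d \<nu> (cyclic_B \<nu> \<psi>) xs = \<dots>" .
  have "cyclic_B \<nu> (cyclic_d \<nu> \<psi>) xs
      = (\<Sum>j<n + 1. signed ((j + 1) * n) (cyclic_d \<nu> \<psi> ((?R ^^ j) xs @ [1])))"
    using len by (auto simp: cyclic_B_def signed_def intro!: sum.cong)
  also have "\<dots> = (\<Sum>j<n + 1. (\<Sum>i=1..n. signed (i + (j + 1) * n) (\<chi> (cyclic_face \<nu> i ((?R ^^ j) xs))))
      + (signed (Suc j * n) (\<psi> ((?R ^^ Suc j) xs)) - signed (j * n) (\<psi> ((?R ^^ j) xs))))"
  proof (intro sum.cong refl)
    fix j
    have "length ((?R ^^ j) xs) = n + 1" using len ne by simp
    from cyclic_d_append_one[OF this, of \<nu> \<psi>]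
    have "signed ((j + 1) * n) (cyclic_d \<nu> \<psi> ((?R ^^ j) xs @ [1]))
        = signed (Suc j * n) (\<psi> ((?R ^^ Suc j) xs))
          + (\<Sum>i=1..n. signed ((j + 1) * n + i) (\<chi> (cyclic_face \<nu> i ((?R ^^ j) xs))))
          + signed ((j + 1) * n + (n + 1)) (\<psi> ((?R ^^ j) xs))"
      by (simp add: signed_add signed_sum signed_signed \<chi>_def)
    also have "signed ((j + 1) * n + (n + 1)) (\<psi> ((?R ^^ j) xs)) = - signed (j * n) (\<psi> ((?R ^^ j) xs))"
      by (simp add: signed_def)
    finally show "signed ((j + 1) * n) (cyclic_d \<nu> \<psi> ((?R ^^ j) xs @ [1]))
        = (\<Sum>i=1..n. signed (i + (j + 1) * n) (\<chi> (cyclic_face \<nu> i ((?R ^^ j) xs))))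
          + (signed (Suc j * n) (\<psi> ((?R ^^ Suc j) xs)) - signed (j * n) (\<psi> ((?R ^^ j) xs)))"
      by (simp add: add_ac)
  qed
  also have "\<dots> = (\<Sum>j<n + 1. \<Sum>i=1..n. signed (i + (j + 1) * n) (\<chi> (cyclic_face \<nu> i ((?R ^^ j) xs))))
      + (signed ((n + 1) * n) (\<psi> ((?R ^^ (n + 1)) xs)) - \<psi> xs)"
    unfolding sum.distrib
    using sum_lessThan_telescope[of "\<lambda>j. signed (j * n) (\<psi> ((?R ^^ j) xs))" "n + 1"]
    by (simp add: signed_def)
  also have "(?R ^^ (n + 1)) xs = map \<nu> xs"
    using rotate_tw_power[of "n + 1" xs \<nu>] len by simp
  also have "signed ((n + 1) * n) (\<psi> (map \<nu> xs)) = \<psi> (map \<nu> xs)"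
    by (simp add: signed_def)
  finally show ?thesis using 1 by simp
qed

section \<open>Cohomology classes\<close>

lemma Union_constant: "x \<in> A \<Longrightarrow> (\<And>y. y \<in> A \<Longrightarrow> F y = X) \<Longrightarrow> (\<Union>y\<in>A. F y) = X"
  by auto

lemma Union_constant_2:
  assumes "x \<in> A" "y \<in> B" "\<And>a b. a \<in> A \<Longrightarrow> b \<in> B \<Longrightarrow> F a b = X"
  shows "(\<Union>a\<in>A. \<Union>b\<in>B. F a b) = X"
  using assms by (intro Union_constant[of x]) auto

context k_algebra
begin

abbreviation A_cocycles :: "int \<Rightarrow> ('a list \<Rightarrow> 'a) set" where
  "A_cocycles \<equiv> cocycles scale (regular_bimodule scale)"

abbreviation A_coboundaries :: "int \<Rightarrow> ('a list \<Rightarrow> 'a) set" where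
  "A_coboundaries \<equiv> coboundaries scale (regular_bimodule scale)"

abbreviation A_class :: "int \<Rightarrow> ('a list \<Rightarrow> 'a) \<Rightarrow> ('a list \<Rightarrow> 'a) set" where
  "A_class \<equiv> coh_class scale (regular_bimodule scale)"

abbreviation HH :: "int \<Rightarrow> ('a list \<Rightarrow> 'a) set set" where
  "HH \<equiv> cohomology scale (regular_bimodule scale)"

lemma A_cocycles_iff: "f \<in> A_cocycles n \<longleftrightarrow> f \<in> A_cochains n \<and> A_d f = 0"
  by (simp add: cocycles_def)

lemma A_coboundariesI: "b \<in> A_cochains (n - 1) \<Longrightarrow> A_d b \<in> A_coboundaries n"
  by (auto simp: coboundaries_def)

lemma A_coboundariesE:
  assumes "f \<in> A_coboundaries n" obtains b where "b \<in> A_cochains (n - 1)" "f = A_d b"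
  using assms by (auto simp: coboundaries_def)

lemma A_coboundaries_subset: "f \<in> A_coboundaries n \<Longrightarrow> f \<in> A_cocycles n"
  using A_d_in[of _ "n - 1"] A_d_d[of _ "n - 1"]
  by (auto simp: A_cocycles_iff elim!: A_coboundariesE)

lemma A_cocycles_zero [simp]: "0 \<in> A_cocycles n"
  by (simp add: A_cocycles_iff)

lemma A_cocycles_add: "f \<in> A_cocycles n \<Longrightarrow> g \<in> A_cocycles n \<Longrightarrow> f + g \<in> A_cocycles n"
  by (simp add: A_cocycles_iff A_cochains_add A_d_add)

lemma A_cocycles_scale: "f \<in> A_cocycles n \<Longrightarrow> (\<lambda>xs. scale r (f xs)) \<in> A_cocycles n"
  by (auto simp: A_cocycles_iff A_cochains_scale A_d_scale)

lemma A_coboundaries_zero [simp]: "0 \<in> A_coboundaries n"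
  using A_coboundariesI[of 0 n] by simp

lemma A_coboundaries_add:
  "f \<in> A_coboundaries n \<Longrightarrow> g \<in> A_coboundaries n \<Longrightarrow> f + g \<in> A_coboundaries n"
  by (auto elim!: A_coboundariesE simp flip: A_d_add intro!: A_coboundariesI A_cochains_add)

lemma A_coboundaries_scale: "f \<in> A_coboundaries n \<Longrightarrow> (\<lambda>xs. scale r (f xs)) \<in> A_coboundaries n"
  by (auto elim!: A_coboundariesE simp flip: A_d_scale intro!: A_coboundariesI A_cochains_scale)

lemma A_coboundaries_minus: "f \<in> A_coboundaries n \<Longrightarrow> - f \<in> A_coboundaries n"
  by (auto elim!: A_coboundariesE simp flip: A_d_minus intro!: A_coboundariesI A_cochains_minus)

lemma A_coboundaries_diff:
  "f \<in> A_coboundaries n \<Longrightarrow> g \<in> A_coboundaries n \<Longrightarrow> f - g \<in> A_coboundaries n"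
  using A_coboundaries_add[of f n "- g"] A_coboundaries_minus[of g n] by simp

lemma A_coboundaries_sum: "(\<And>i. i \<in> I \<Longrightarrow> F i \<in> A_coboundaries n) \<Longrightarrow> sum F I \<in> A_coboundaries n"
  by (induction I rule: infinite_finite_induct) (simp_all add: A_coboundaries_add)

lemma A_class_iff: "g \<in> A_class n f \<longleftrightarrow> g - f \<in> A_coboundaries n"
  by (simp add: coh_class_def)

lemma A_class_self [simp]: "f \<in> A_class n f"
  by (simp add: A_class_iff)

lemma A_class_eqI: assumes "f - g \<in> A_coboundaries n" shows "A_class n f = A_class n g"
proof -
  have "h - f \<in> A_coboundaries n \<longleftrightarrow> h - g \<in> A_coboundaries n" for h
    using A_coboundaries_add[OF _ assms, of "h - f"] A_coboundaries_diff[OF _ assms, of "h - g"]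
    by auto
  then show ?thesis by (auto simp: A_class_iff)
qed

lemma HH_I: "f \<in> A_cocycles n \<Longrightarrow> A_class n f \<in> HH n"
  by (auto simp: cohomology_def)

lemma HH_E: assumes "c \<in> HH n" obtains f where "f \<in> A_cocycles n" "c = A_class n f"
  using assms by (auto simp: cohomology_def)

lemma A_class_cocycle: assumes "f \<in> A_cocycles n" "g \<in> A_class n f" shows "g \<in> A_cocycles n"
  using A_cocycles_add[OF A_coboundaries_subset assms(1), of "g - f"] assms(2)
  by (simp add: A_class_iff)

definition cochain_bilinear ::
    "int \<Rightarrow> int \<Rightarrow> (('a list \<Rightarrow> 'a) \<Rightarrow> ('a list \<Rightarrow> 'a) \<Rightarrow> ('a list \<Rightarrow> 'a)) \<Rightarrow> bool" where
  "cochain_bilinear n m P \<longleftrightarrow>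
     (\<forall>f\<in>A_cochains n. \<forall>f'\<in>A_cochains n. \<forall>g\<in>A_cochains m. P (f + f') g = P f g + P f' g) \<and>
     (\<forall>f\<in>A_cochains n. \<forall>g\<in>A_cochains m. \<forall>g'\<in>A_cochains m. P f (g + g') = P f g + P f g') \<and>
     (\<forall>r. \<forall>f\<in>A_cochains n. \<forall>g\<in>A_cochains m.
        P (\<lambda>xs. scale r (f xs)) g = (\<lambda>xs. scale r (P f g xs)) \<and>
        P f (\<lambda>xs. scale r (g xs)) = (\<lambda>xs. scale r (P f g xs)))"

text \<open>The conditions under which a bilinear operation on cochains is well defined on cohomology.\<close>

definition descends ::
    "int \<Rightarrow> int \<Rightarrow> int \<Rightarrow> (('a list \<Rightarrow> 'a) \<Rightarrow> ('a list \<Rightarrow> 'a) \<Rightarrow> ('a list \<Rightarrow> 'a)) \<Rightarrow> bool" where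
  "descends n m p P \<longleftrightarrow>
     (\<forall>f\<in>A_cocycles n. \<forall>g\<in>A_cocycles m. P f g \<in> A_cocycles p) \<and>
     (\<forall>f\<in>A_coboundaries n. \<forall>g\<in>A_cocycles m. P f g \<in> A_coboundaries p) \<and>
     (\<forall>f\<in>A_cocycles n. \<forall>g\<in>A_coboundaries m. P f g \<in> A_coboundaries p)"

lemma class_operation:
  assumes bil: "cochain_bilinear n m P" and desc: "descends n m p P"
    and f: "f \<in> A_cocycles n" and g: "g \<in> A_cocycles m"
  shows "(\<Union>f'\<in>A_class n f. \<Union>g'\<in>A_class m g. A_class p (P f' g')) = A_class p (P f g)"
proof -
  have "A_class p (P f' g') = A_class p (P f g)" if f': "f' \<in> A_class n f" and g': "g' \<in> A_class m g" for f' g'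
  proof (rule A_class_eqI)
    have fB: "f' - f \<in> A_coboundaries n" and gB: "g' - g \<in> A_coboundaries m"
      using f' g' by (simp_all add: A_class_iff)
    note [simp] = f[unfolded A_cocycles_iff] g[unfolded A_cocycles_iff]
      A_class_cocycle[OF f f', unfolded A_cocycles_iff] A_class_cocycle[OF g g', unfolded A_cocycles_iff]
    note fB' = A_coboundaries_subset[OF fB, unfolded A_cocycles_iff]
    note gB' = A_coboundaries_subset[OF gB, unfolded A_cocycles_iff]
    have left: "P (a + b) h = P a h + P b h"
      if "a \<in> A_cochains n" "b \<in> A_cochains n" "h \<in> A_cochains m" for a b h
      using bil that by (simp add: cochain_bilinear_def)
    have right: "P h (a + b) = P h a + P h b"
      if "a \<in> A_cochains m" "b \<in> A_cochains m" "h \<in> A_cochains n" for a b h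
      using bil that by (simp add: cochain_bilinear_def)
    have "P f' g' = P f g' + P (f' - f) g'" "P f g' = P f g + P f (g' - g)"
      using left[of f "f' - f" g'] right[of g "g' - g" f] fB' gB' by simp_all
    then have "P f' g' - P f g = P f (g' - g) + P (f' - f) g'" by simp
    then show "P f' g' - P f g \<in> A_coboundaries p"
      using desc fB gB f A_class_cocycle[OF g g'] by (simp add: descends_def A_coboundaries_add)
  qed
  then show ?thesis by (intro Union_constant_2[OF A_class_self A_class_self])
qed

definition class_add :: "int \<Rightarrow> ('a list \<Rightarrow> 'a) set \<Rightarrow> ('a list \<Rightarrow> 'a) set \<Rightarrow> ('a list \<Rightarrow> 'a) set" where
  "class_add n c d = (\<Union>f\<in>c. \<Union>g\<in>d. A_class n (f + g))"

definition class_scale :: "int \<Rightarrow> 'k \<Rightarrow> ('a list \<Rightarrow> 'a) set \<Rightarrow> ('a list \<Rightarrow> 'a) set" where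
  "class_scale n r c = (\<Union>f\<in>c. A_class n (\<lambda>xs. scale r (f xs)))"

lemma class_add_eq: "class_add n (A_class n f) (A_class n g) = A_class n (f + g)"
proof -
  have "A_class n (f' + g') = A_class n (f + g)" if "f' \<in> A_class n f" "g' \<in> A_class n g" for f' g'
    using that A_coboundaries_add[of "f' - f" n "g' - g"]
    by (intro A_class_eqI) (simp add: A_class_iff add_diff_add)
  then show ?thesis unfolding class_add_def by (intro Union_constant_2[OF A_class_self A_class_self])
qed

lemma scale_diff_fun: "(\<lambda>xs. scale r (f xs)) - (\<lambda>xs. scale r (g xs)) = (\<lambda>xs. scale r ((f - g) xs))"
  for f g :: "'a list \<Rightarrow> 'a"
  by (auto simp: scale_right_diff_distrib)

lemma class_scale_eq: "class_scale n r (A_class n f) = A_class n (\<lambda>xs. scale r (f xs))"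
proof -
  have "A_class n (\<lambda>xs. scale r (f' xs)) = A_class n (\<lambda>xs. scale r (f xs))" if "f' \<in> A_class n f" for f'
    using that A_coboundaries_scale[of "f' - f" n r]
    by (intro A_class_eqI) (simp add: A_class_iff scale_diff_fun)
  then show ?thesis unfolding class_scale_def by (intro Union_constant[OF A_class_self])
qed

lemma HH_data_simps [simp]:
  "comp (HH_data scale form \<nu>) = HH"
  "hadd (HH_data scale form \<nu>) = class_add"
  "hzero (HH_data scale form \<nu>) n = A_class n 0"
  "hscale (HH_data scale form \<nu>) = class_scale"
  "cup (HH_data scale form \<nu>) n m c d = (\<Union>f\<in>c. \<Union>g\<in>d. A_class (n + m) (cup_cochain (*) n m f g))"
  "brk (HH_data scale form \<nu>) n m c d = (\<Union>f\<in>c. \<Union>g\<in>d. A_class (n + m - 1) (A_bracket n m f g))"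
  "bvop (HH_data scale form \<nu>) n c
     = (\<Union>f\<in>{f\<in>c. nu_invariant \<nu> f}. A_class (n - 1) (Delta_cochain form \<nu> n f))"
  by (auto simp: HH_data_def Let_def class_add_def class_scale_def regular_bimodule_def fun_eq_iff)

lemma graded_module_HH: "graded_module (HH_data scale form \<nu>)"
proof -
  have [simp]: "f + (\<lambda>xs. - f xs) = 0" for f :: "'a list \<Rightarrow> 'a" by auto
  have [simp]: "(\<lambda>xs. scale r (f xs)) + (\<lambda>xs. scale s (g xs)) = (\<lambda>xs. scale r (f xs) + scale s (g xs))"
    for f g :: "'a list \<Rightarrow> 'a" and r s by auto
  show ?thesis
    unfolding graded_module_def
    by (auto elim!: HH_E simp: class_add_eq class_scale_eq HH_I A_cocycles_add A_cocycles_scale add_ac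
        scale_left_distrib scale_right_distrib)
qed

text \<open>The map on representatives need be linear only up to coboundaries.\<close>

lemma graded_linear_HH_I:
  assumes T: "\<And>f. f \<in> A_cocycles n \<Longrightarrow> T (A_class n f) = A_class p (t f)"
    and t: "\<And>f. f \<in> A_cocycles n \<Longrightarrow> t f \<in> A_cocycles p"
    and add: "\<And>f g. f \<in> A_cocycles n \<Longrightarrow> g \<in> A_cocycles n
      \<Longrightarrow> t (f + g) - (t f + t g) \<in> A_coboundaries p"
    and scale: "\<And>r f. f \<in> A_cocycles n
      \<Longrightarrow> t (\<lambda>xs. scale r (f xs)) - (\<lambda>xs. scale r (t f xs)) \<in> A_coboundaries p"
  shows "graded_linear (HH_data scale form \<nu>) n p T"
  unfolding graded_linear_def HH_data_simps
proof (intro conjI ballI allI)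
  fix c assume "c \<in> HH n"
  then obtain f where f: "f \<in> A_cocycles n" "c = A_class n f" by (rule HH_E)
  then show "T c \<in> HH p" by (simp add: T t HH_I)
  show "T (class_scale n r c) = class_scale p r (T c)" for r
    using f A_class_eqI[OF scale[OF f(1)]] by (simp add: T A_cocycles_scale class_scale_eq)
  fix d assume "d \<in> HH n"
  then obtain g where g: "g \<in> A_cocycles n" "d = A_class n g" by (rule HH_E)
  show "T (class_add n c d) = class_add p (T c) (T d)"
    using f g A_class_eqI[OF add[OF f(1) g(1)]] by (simp add: T A_cocycles_add class_add_eq)
qed

lemma class_operation_linear_right:
  assumes bil: "cochain_bilinear n m P" and desc: "descends n m p P" and c: "c \<in> HH n"
  shows "graded_linear (HH_data scale form \<nu>) m p (\<lambda>d. \<Union>f\<in>c. \<Union>g\<in>d. A_class p (P f g))"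
proof -
  obtain f where f: "f \<in> A_cocycles n" "c = A_class n f" using c by (rule HH_E)
  show ?thesis
  proof (rule graded_linear_HH_I[where t = "P f"])
    fix g assume g: "g \<in> A_cocycles m"
    show "(\<Union>f\<in>c. \<Union>g\<in>A_class m g. A_class p (P f g)) = A_class p (P f g)"
      unfolding f(2) by (rule class_operation[OF bil desc f(1) g])
    show "P f g \<in> A_cocycles p" using desc f(1) g by (simp add: descends_def)
    have "P f (\<lambda>xs. scale r (g xs)) = (\<lambda>xs. scale r (P f g xs))" for r
      using bil f(1) g by (simp add: cochain_bilinear_def A_cocycles_iff)
    then show "P f (\<lambda>xs. scale r (g xs)) - (\<lambda>xs. scale r (P f g xs)) \<in> A_coboundaries p" for r
      by simp
    fix g' assume g': "g' \<in> A_cocycles m"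
    have "P f (g + g') = P f g + P f g'"
      using bil f(1) g g' by (simp add: cochain_bilinear_def A_cocycles_iff)
    then show "P f (g + g') - (P f g + P f g') \<in> A_coboundaries p" by simp
  qed
qed

lemma class_operation_linear_left:
  assumes bil: "cochain_bilinear n m P" and desc: "descends n m p P" and d: "d \<in> HH m"
  shows "graded_linear (HH_data scale form \<nu>) n p (\<lambda>c. \<Union>f\<in>c. \<Union>g\<in>d. A_class p (P f g))"
proof -
  obtain g where g: "g \<in> A_cocycles m" "d = A_class m g" using d by (rule HH_E)
  show ?thesis
  proof (rule graded_linear_HH_I[where t = "\<lambda>f. P f g"])
    fix f assume f: "f \<in> A_cocycles n"
    show "(\<Union>f\<in>A_class n f. \<Union>g\<in>d. A_class p (P f g)) = A_class p (P f g)"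
      unfolding g(2) by (rule class_operation[OF bil desc f g(1)])
    show "P f g \<in> A_cocycles p" using desc f g(1) by (simp add: descends_def)
    have "P (\<lambda>xs. scale r (f xs)) g = (\<lambda>xs. scale r (P f g xs))" for r
      using bil f g(1) by (simp add: cochain_bilinear_def A_cocycles_iff)
    then show "P (\<lambda>xs. scale r (f xs)) g - (\<lambda>xs. scale r (P f g xs)) \<in> A_coboundaries p" for r
      by simp
    fix f' assume f': "f' \<in> A_cocycles n"
    have "P (f + f') g = P f g + P f' g"
      using bil f g(1) f' by (simp add: cochain_bilinear_def A_cocycles_iff)
    then show "P (f + f') g - (P f g + P f' g) \<in> A_coboundaries p" by simp
  qed
qed

lemma cup_bilinear: "cochain_bilinear n m (cup_cochain (*) n m)"
  by (auto simp: cochain_bilinear_def cup_cochain_def fun_eq_iff distrib_left distrib_right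
      scale_mult_left[symmetric] scale_mult_right[symmetric])

lemma cup_descends: "descends n m (n + m) (cup_cochain (*) n m)"
  unfolding descends_def
proof (intro conjI ballI)
  fix f g assume "f \<in> A_cocycles n" "g \<in> A_cocycles m"
  then show "cup_cochain (*) n m f g \<in> A_cocycles (n + m)"
    by (simp add: A_cocycles_iff cup_in A_d_cup_int)
next
  fix f g assume "f \<in> A_coboundaries n" and g: "g \<in> A_cocycles m"
  then obtain b where b: "b \<in> A_cochains (n - 1)" "f = A_d b" by (auto elim: A_coboundariesE)
  have "A_d (cup_cochain (*) (n - 1) m b g) = cup_cochain (*) n m f g"
    using A_d_cup_int[OF b(1), of g m] g b(2) by (simp add: A_cocycles_iff)
  moreover have "cup_cochain (*) (n - 1) m b g \<in> A_cochains (n + m - 1)"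
    using cup_in[OF b(1), of g m] g by (simp add: A_cocycles_iff algebra_simps)
  ultimately show "cup_cochain (*) n m f g \<in> A_coboundaries (n + m)"
    using A_coboundariesI by metis
next
  fix f g assume f: "f \<in> A_cocycles n" and "g \<in> A_coboundaries m"
  then obtain b where b: "b \<in> A_cochains (m - 1)" "g = A_d b" by (auto elim: A_coboundariesE)
  have "A_d (cup_cochain (*) n (m - 1) f b) = signed (nat n) (cup_cochain (*) n m f g)"
    using A_d_cup_int[of f n b "m - 1"] b f by (simp add: A_cocycles_iff)
  then have "A_d (signed (nat n) (cup_cochain (*) n (m - 1) f b)) = cup_cochain (*) n m f g"
    by (simp add: A_d_signed signed_signed) (simp add: signed_def)
  moreover have "signed (nat n) (cup_cochain (*) n (m - 1) f b) \<in> A_cochains (n + m - 1)"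
    using cup_in[of f n b "m - 1"] f b(1) by (simp add: A_cocycles_iff algebra_simps A_cochains_signed)
  ultimately show "cup_cochain (*) n m f g \<in> A_coboundaries (n + m)"
    using A_coboundariesI by metis
qed

lemma signed_scale: "signed j (scale r x) = scale r (signed j x)"
  by (simp add: signed_def)

lemma commutator_scale_left:
  assumes g: "g \<in> A_cochains k"
  shows "commutator n m (\<lambda>xs. scale r (f xs)) g = (\<lambda>xs. scale r (commutator n m f g xs))"
proof (rule ext)
  fix xs
  show "commutator n m (\<lambda>xs. scale r (f xs)) g xs = scale r (commutator n m f g xs)"
    by (auto simp: commutator_def circ_def insert_at_def signed_apply scale_right_diff_distrib
      scale_sum_right signed_sum signed_scale A_cochains_homogeneous[OF g])
qed

lemma commutator_scale_right:
  assumes f: "f \<in> A_cochains k"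
  shows "commutator n m f (\<lambda>xs. scale r (g xs)) = (\<lambda>xs. scale r (commutator n m f g xs))"
proof (rule ext)
  fix xs
  show "commutator n m f (\<lambda>xs. scale r (g xs)) xs = scale r (commutator n m f g xs)"
    by (auto simp: commutator_def circ_def insert_at_def signed_apply scale_right_diff_distrib
      scale_sum_right signed_sum signed_scale A_cochains_homogeneous[OF f])
qed

lemma bracket_bilinear: "cochain_bilinear n m (A_bracket n m)"
  unfolding cochain_bilinear_def
proof (intro conjI ballI allI)
  fix f f' g assume *: "f \<in> A_cochains n" "f' \<in> A_cochains n" "g \<in> A_cochains m"
  then show "A_bracket n m (f + f') g = A_bracket n m f g + A_bracket n m f' g"
    by (simp add: bracket_eq_commutator A_cochains_add commutator_def circ_add_left
      circ_add_right[OF A_cochains_additive[OF *(3)]] signed_add)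
next
  fix f g g' assume *: "f \<in> A_cochains n" "g \<in> A_cochains m" "g' \<in> A_cochains m"
  then show "A_bracket n m f (g + g') = A_bracket n m f g + A_bracket n m f g'"
    by (simp add: bracket_eq_commutator A_cochains_add commutator_def circ_add_left
      circ_add_right[OF A_cochains_additive[OF *(1)]] signed_add)
next
  fix r f g assume *: "f \<in> A_cochains n" "g \<in> A_cochains m"
  show "A_bracket n m (\<lambda>xs. scale r (f xs)) g = (\<lambda>xs. scale r (A_bracket n m f g xs))"
    using * A_cochains_scale[OF *(1)]
    by (simp add: bracket_eq_commutator commutator_scale_left[OF *(2)])
  show "A_bracket n m f (\<lambda>xs. scale r (g xs)) = (\<lambda>xs. scale r (A_bracket n m f g xs))"
    using * A_cochains_scale[OF *(2)]
    by (simp add: bracket_eq_commutator commutator_scale_right[OF *(1)])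
qed

lemma bracket_zero_left: "g \<in> A_cochains m \<Longrightarrow> A_bracket n m 0 g = 0"
  using bracket_eq_commutator[of 0 n g m] A_cochains_additive[of g m] by simp

lemma bracket_zero_right: "f \<in> A_cochains n \<Longrightarrow> A_bracket n m f 0 = 0"
  using bracket_eq_commutator[of f n 0 m] A_cochains_additive[of f n] by simp

lemma bracket_descends: "descends n m (n + m - 1) (A_bracket n m)"
  unfolding descends_def
proof (intro conjI ballI)
  fix f g assume "f \<in> A_cocycles n" "g \<in> A_cocycles m"
  then show "A_bracket n m f g \<in> A_cocycles (n + m - 1)"
    by (simp add: A_cocycles_iff bracket_in A_d_bracket bracket_zero_left bracket_zero_right)
next
  fix f g assume "f \<in> A_coboundaries n" and g: "g \<in> A_cocycles m"
  then obtain b where b: "b \<in> A_cochains (n - 1)" "f = A_d b" by (auto elim: A_coboundariesE)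
  have "A_d (A_bracket (n - 1) m b g) = signed (nat m + 1) (A_bracket n m f g)"
    using A_d_bracket[OF b(1), of g m] g b by (simp add: A_cocycles_iff bracket_zero_right)
  then have "A_d (signed (nat m + 1) (A_bracket (n - 1) m b g)) = A_bracket n m f g"
    by (simp add: A_d_signed signed_signed) (simp add: signed_def)
  moreover have "signed (nat m + 1) (A_bracket (n - 1) m b g) \<in> A_cochains (n + m - 1 - 1)"
    using bracket_in[OF b(1), of g m] g by (simp add: A_cocycles_iff algebra_simps A_cochains_signed)
  ultimately show "A_bracket n m f g \<in> A_coboundaries (n + m - 1)"
    using A_coboundariesI by metis
next
  fix f g assume f: "f \<in> A_cocycles n" and "g \<in> A_coboundaries m"
  then obtain b where b: "b \<in> A_cochains (m - 1)" "g = A_d b" by (auto elim: A_coboundariesE)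
  have "A_d (A_bracket n (m - 1) f b) = A_bracket n m f g"
    using A_d_bracket[of f n b "m - 1"] b f by (simp add: A_cocycles_iff bracket_zero_left)
  moreover have "A_bracket n (m - 1) f b \<in> A_cochains (n + m - 1 - 1)"
    using bracket_in[of f n b "m - 1"] f b(1) by (simp add: A_cocycles_iff algebra_simps)
  ultimately show "A_bracket n m f g \<in> A_coboundaries (n + m - 1)"
    using A_coboundariesI by metis
qed

end

section \<open>Frobenius algebras\<close>

lemma merge_map:
  assumes "\<And>a b. \<nu> (a * b) = \<nu> a * \<nu> b" "0 < i" "i < length xs"
  shows "merge i (map \<nu> xs) = map \<nu> (merge i xs)"
  using assms by (auto simp: merge_def take_map drop_map)

text \<open>An argument of the cochain occurs once in the word, possibly under \<open>\<nu>\<close>.\<close>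

lemma bv_word_slot:
  "\<exists>us vs \<mu>. (\<mu> = id \<or> \<mu> = \<nu>) \<and> (\<forall>x. bv_word \<nu> i a (xs @ x # ys) = us @ \<mu> x # vs)"
proof -
  consider "i = 0" | "i > 0" "length xs < i - 1" | "i > 0" "i - 1 \<le> length xs" by linarith
  then show ?thesis
  proof cases
    case 1
    then have "\<forall>x. bv_word \<nu> i a (xs @ x # ys) = (a # map \<nu> xs) @ \<nu> x # map \<nu> ys"
      by (simp add: bv_word_def)
    then show ?thesis by blast
  next
    case 2
    then have "\<forall>x. bv_word \<nu> i a (xs @ x # ys)
        = (drop (i - 1 - length xs - 1) ys @ a # map \<nu> xs) @ \<nu> x # map \<nu> (take (i - 1 - length xs - 1) ys)"
      by (simp add: bv_word_def take_Cons' drop_Cons')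
    then show ?thesis by blast
  next
    case 3
    then have "\<forall>x. bv_word \<nu> i a (xs @ x # ys)
        = drop (i - 1) xs @ id x # (ys @ a # map \<nu> (take (i - 1) xs))"
      by (simp add: bv_word_def)
    then show ?thesis by blast
  qed
qed

lemma bv_word_insert: "\<exists>us vs. \<forall>a. bv_word \<nu> i a xs = us @ a # vs"
proof (cases "i = 0")
  case True
  then have "\<forall>a. bv_word \<nu> i a xs = [] @ a # map \<nu> xs" by (simp add: bv_word_def)
  then show ?thesis by blast
qed (auto simp: bv_word_def)

text \<open>The word of index \<open>j + 1\<close> is the \<open>j\<close>-th twisted rotation of \<open>a\<^sub>1, \<dots>, a\<^sub>n\<^sub>-\<^sub>1, a\<^sub>0\<close>, and the
  word of index \<open>0\<close> is the last one, \<open>j = n - 1\<close>; its sign agrees because \<open>n (n - 1)\<close> is even.\<close>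

lemma sum_bv_word:
  assumes "length xs + 1 = n"
  shows "(\<Sum>i<n. signed (i * (n + 1)) (F (bv_word \<nu> i a xs)))
       = (\<Sum>j<n. signed ((j + 1) * (n + 1)) (F ((rotate_tw \<nu> ^^ j) (xs @ [a]))))"
proof -
  obtain m where n: "n = Suc m" and m: "length xs = m" using assms by auto
  have w: "bv_word \<nu> (Suc j) a xs = (rotate_tw \<nu> ^^ j) (xs @ [a])" if "j < m" for j
    using that m by (simp add: bv_word_def rotate_tw_power)
  have "bv_word \<nu> 0 a xs = (rotate_tw \<nu> ^^ m) (xs @ [a])"
    using m by (simp add: bv_word_def rotate_tw_power)
  moreover have "signed ((m + 1) * (n + 1)) y = y" "signed 0 y = y" for y :: 'b
    by (simp_all add: n signed_def)
  ultimately show ?thesis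
    unfolding n by (subst sum.lessThan_Suc_shift, subst sum.lessThan_Suc) (simp add: w add.commute n)
qed

lemma (in k_algebra) linear_functional_iff:
  "Vector_Spaces.linear scale (*) \<phi> \<longleftrightarrow> (\<forall>x y. \<phi> (x + y) = \<phi> x + \<phi> y) \<and> (\<forall>r x. \<phi> (scale r x) = r * \<phi> x)"
proof -
  have "vector_space scale" by (rule vector_space_axioms)
  moreover have "vector_space ((*) :: 'k \<Rightarrow> 'k \<Rightarrow> 'k)" by unfold_locales (simp_all add: algebra_simps)
  ultimately show ?thesis by (simp add: Vector_Spaces.linear_iff)
qed

context frobenius_algebra
begin

lemma form_add_right: "form a (x + y) = form a x + form a y"
  and form_scale_right: "form a (scale r x) = r * form a x"
  using form_linear_right[of a] by (simp_all add: linear_functional_iff)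

lemma form_add_left: "form (x + y) a = form x a + form y a"
  and form_scale_left: "form (scale r x) a = r * form x a"
  using form_linear_left[of a] by (simp_all add: linear_functional_iff)

lemma form_zero_left [simp]: "form 0 a = 0"
  using form_scale_left[of 0 0 a] by simp

lemma form_minus_left: "form (- x) a = - form x a"
  using form_add_left[of x "- x" a] by (simp add: eq_neg_iff_add_eq_0 add.commute)

lemma form_diff_left: "form (x - y) a = form x a - form y a"
  using form_add_left[of x "- y" a] by (simp add: form_minus_left)

lemma form_signed_left: "form (signed k x) a = signed k (form x a)"
  by (simp add: signed_def form_minus_left)

lemma form_sum_left: "form (sum x I) a = (\<Sum>i\<in>I. form (x i) a)"
  by (induction I rule: infinite_finite_induct) (simp_all add: form_add_left)

lemma form_eqI: assumes "\<And>c. form a c = form b c" shows "a = b"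
  using form_nondeg_left[of "a - b"] assms by (simp add: form_diff_left)

abbreviation Z :: "'a \<Rightarrow> ('a \<Rightarrow> 'k)" where
  "Z \<equiv> frob_iso form"

lemma inj_Z: "inj Z"
  by (rule injI) (auto simp: frob_iso_def fun_eq_iff intro: form_eqI)

lemma linear_Z: "Vector_Spaces.linear scale (*) (Z a)"
  by (simp add: frob_iso_def form_linear_right)

text \<open>On a finite-dimensional space, an injective linear map to the dual is onto.  To stay within
  endomorphisms of \<open>A\<close>, a functional is represented by the vector whose coordinates in a basis are
  its values on that basis; \<open>T\<close> is \<open>Z\<close> in this disguise.\<close>

lemma Z_surjective:
  assumes \<phi>: "Vector_Spaces.linear scale (*) \<phi>"
  obtains a where "Z a = \<phi>"
proof -
  obtain B where B: "finite B" "span B = UNIV" using finite_dimensional by auto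
  obtain B' where B': "B' \<subseteq> B" "independent B'" "B \<subseteq> span B'" by (rule maximal_independent_subset)
  have span: "span B' = UNIV"
    using span_minimal[OF B'(3) subspace_span] B(2) by auto
  interpret fd: finite_dimensional_vector_space scale B'
    by unfold_locales (use B B' span finite_subset in auto)
  define T where "T a = (\<Sum>b\<in>B'. scale (form a b) b)" for a
  have "Vector_Spaces.linear scale scale T"
    by (simp add: Vector_Spaces.linear_iff vector_space_axioms T_def form_add_left form_scale_left
        scale_left_distrib sum.distrib scale_sum_right)
  moreover have eq: "form a c = \<phi> c" if "\<And>b. b \<in> B' \<Longrightarrow> form a b = \<phi> b"
    "Vector_Spaces.linear scale (*) \<phi>" for a c \<phi>
  proof -
    have "c \<in> span B'" using span by simp
    then show ?thesis
    proof (induction rule: span_induct)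
      case base
      have "form a 0 = 0" "\<phi> 0 = 0"
        using form_scale_right[of a 0 0] that(2)[unfolded linear_functional_iff, THEN conjunct2, rule_format, of 0 0]
        by simp_all
      then show ?case
        using that(2) by (auto simp: subspace_def form_add_right form_scale_right linear_functional_iff)
    qed (use that in auto)
  qed
  have coord: "form a b = form a' b" if "T a = T a'" "b \<in> B'" for a a' b
  proof -
    have "(\<Sum>b\<in>B'. scale (form a b - form a' b) b) = 0"
      using that(1) by (simp add: T_def scale_left_diff_distrib sum_subtractf)
    then have "form a b - form a' b = 0"
      using independentD[OF B'(2) fd.finite_Basis subset_refl _ that(2)] by metis
    then show ?thesis by simp
  qed
  have "inj T"
  proof (rule injI)
    fix a a' assume "T a = T a'"
    from coord[OF this] show "a = a'"
      by (intro form_eqI, rule eq[of _ "form a'"]) (auto simp: form_linear_right)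
  qed
  ultimately have "surj T" using fd.linear_inj_imp_surj by blast
  then obtain a where a: "T a = (\<Sum>b\<in>B'. scale (\<phi> b) b)" by (metis surjD)
  have "form a b = \<phi> b" if "b \<in> B'" for b
  proof -
    have "(\<Sum>b\<in>B'. scale (form a b - \<phi> b) b) = 0"
      using a by (simp add: T_def scale_left_diff_distrib sum_subtractf)
    then have "form a b - \<phi> b = 0"
      using independentD[OF B'(2) fd.finite_Basis subset_refl _ that] by metis
    then show ?thesis by simp
  qed
  then have "Z a = \<phi>" using eq[OF _ \<phi>] by (auto simp: frob_iso_def)
  then show ?thesis by (rule that)
qed

lemma inv_Z [simp]: "inv Z (Z a) = a"
  by (rule inv_f_f[OF inj_Z])

text \<open>The argument \<open>a\<^sub>0\<close> comes last, so that twisted rotations act on the whole word.\<close>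

definition as_form :: "('a list \<Rightarrow> 'a) \<Rightarrow> 'a list \<Rightarrow> 'k" where
  "as_form f ys = form (f (butlast ys)) (last ys)"

end

locale nakayama_algebra = frobenius_algebra scale form
  for scale :: "'k::field \<Rightarrow> 'a::{ring,monoid_mult} \<Rightarrow> 'a" and form :: "'a \<Rightarrow> 'a \<Rightarrow> 'k" +
  fixes \<nu> :: "'a \<Rightarrow> 'a"
  assumes nakayama: "nakayama_automorphism scale form \<nu>"
begin

lemma nu_mult: "\<nu> (a * b) = \<nu> a * \<nu> b"
  and bij_nu: "bij \<nu>"
  and nu_add: "\<nu> (a + b) = \<nu> a + \<nu> b"
  and nu_scale: "\<nu> (scale r a) = scale r (\<nu> a)"
  and form_nu: "form a b = form b (\<nu> a)"
  using nakayama
  by (simp_all add: nakayama_automorphism_def algebra_automorphism_def Vector_Spaces.linear_iff)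

lemma nu_inv [simp]: "\<nu> (inv \<nu> a) = a" "inv \<nu> (\<nu> a) = a"
  using bij_nu by (simp_all add: bij_is_surj surj_f_inv_f bij_is_inj)

lemma inv_nu_eq_iff: "inv \<nu> a = b \<longleftrightarrow> a = \<nu> b"
  by (metis nu_inv)

lemma inv_nu_mult: "inv \<nu> (a * b) = inv \<nu> a * inv \<nu> b"
  and inv_nu_add: "inv \<nu> (a + b) = inv \<nu> a + inv \<nu> b"
  and inv_nu_scale: "inv \<nu> (scale r a) = scale r (inv \<nu> a)"
  by (simp_all add: inv_nu_eq_iff nu_mult nu_add nu_scale)

lemma inv_nu_zero [simp]: "inv \<nu> 0 = 0"
  using inv_nu_add[of 0 0] by simp

lemma inv_nu_sum: "inv \<nu> (sum F I) = (\<Sum>i\<in>I. inv \<nu> (F i))"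
  by (induction I rule: infinite_finite_induct) (simp_all add: inv_nu_add)

lemma form_nu_nu: "form (\<nu> a) (\<nu> b) = form a b"
  using form_nu form_nu by metis

lemma form_inv_nu: "form (inv \<nu> a) b = form a (\<nu> b)"
  using form_nu_nu[of "inv \<nu> a" b] by simp

text \<open>This identity makes \<open>Z\<close> compatible with the left actions.\<close>

lemma form_mult_left: "form (a * x) b = form x (b * \<nu> a)"
  by (metis form_assoc form_nu)

text \<open>The right-hand side is linear in \<open>a\<close>, hence represented by a vector, which is unique because
  the form is non-degenerate.  So the definite description in \<open>Delta_cochain\<close> denotes on cochains.\<close>

lemma Delta_form:
  assumes f: "f \<in> A_cochains n" and len: "int (length xs) = n - 1"
  shows "form (Delta_cochain form \<nu> n f xs) a
    = (\<Sum>i<nat n. (-1) powi (int i * (n - 1)) * form (f (bv_word \<nu> i a xs)) 1)"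
proof -
  let ?\<phi> = "\<lambda>a. \<Sum>i<nat n. (-1) powi (int i * (n - 1)) * form (f (bv_word \<nu> i a xs)) 1"
  have "form (f (bv_word \<nu> i (x + y) xs)) 1 = form (f (bv_word \<nu> i x xs)) 1 + form (f (bv_word \<nu> i y xs)) 1"
    "form (f (bv_word \<nu> i (scale r x) xs)) 1 = r * form (f (bv_word \<nu> i x xs)) 1" for i x y r
    using bv_word_insert[of \<nu> i xs]
    by (auto simp: slot_additiveD[OF A_cochains_additive[OF f]] A_cochains_homogeneous[OF f]
        form_add_left form_scale_left)
  then have "Vector_Spaces.linear scale (*) ?\<phi>"
    by (simp add: linear_functional_iff sum.distrib distrib_left sum_distrib_left mult.left_commute)
  then obtain b where "Z b = ?\<phi>" by (rule Z_surjective)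
  then have b: "form b a = ?\<phi> a" for a by (simp add: frob_iso_def fun_eq_iff)
  have "Delta_cochain form \<nu> n f xs = b"
    unfolding Delta_cochain_def using len
    by (simp add: b[symmetric]) (rule the_equality, auto intro: form_eqI)
  then show ?thesis by (simp add: b)
qed

lemma Delta_off_degree: "int (length xs) \<noteq> n - 1 \<Longrightarrow> Delta_cochain form \<nu> n f xs = 0"
  by (simp add: Delta_cochain_def)

lemma Delta_in:
  assumes f: "f \<in> A_cochains n" shows "Delta_cochain form \<nu> n f \<in> A_cochains (n - 1)"
  unfolding A_cochains_iff slot_additive_def
proof (intro conjI allI impI)
  have slot: "f (bv_word \<nu> i a (us @ (x + y) # vs)) = f (bv_word \<nu> i a (us @ x # vs)) + f (bv_word \<nu> i a (us @ y # vs))"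
    "f (bv_word \<nu> i a (us @ scale r x # vs)) = scale r (f (bv_word \<nu> i a (us @ x # vs)))"
    for i a us vs x y r
    using bv_word_slot[of \<nu> i a us vs]
    by (auto simp: slot_additiveD[OF A_cochains_additive[OF f]] A_cochains_homogeneous[OF f]
        nu_add nu_scale)
  fix xs ys x y r
  show "Delta_cochain form \<nu> n f (xs @ (x + y) # ys)
      = Delta_cochain form \<nu> n f (xs @ x # ys) + Delta_cochain form \<nu> n f (xs @ y # ys)"
  proof (cases "int (length xs + length ys + 1) = n - 1")
    case True
    then show ?thesis
      by (intro form_eqI) (simp add: Delta_form[OF f] form_add_left slot sum.distrib distrib_left)
  qed (simp add: Delta_off_degree)
  show "Delta_cochain form \<nu> n f (xs @ scale r x # ys) = scale r (Delta_cochain form \<nu> n f (xs @ x # ys))"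
  proof (cases "int (length xs + length ys + 1) = n - 1")
    case True
    then show ?thesis
      by (intro form_eqI)
        (simp add: Delta_form[OF f] form_scale_left slot sum_distrib_left mult.left_commute)
  qed (simp add: Delta_off_degree)
qed (simp add: Delta_off_degree)

lemma Delta_add:
  assumes "f \<in> A_cochains n" "g \<in> A_cochains n"
  shows "Delta_cochain form \<nu> n (f + g) = Delta_cochain form \<nu> n f + Delta_cochain form \<nu> n g"
proof (rule ext)
  fix xs
  show "Delta_cochain form \<nu> n (f + g) xs = (Delta_cochain form \<nu> n f + Delta_cochain form \<nu> n g) xs"
  proof (cases "int (length xs) = n - 1")
    case True
    then show ?thesis
      by (intro form_eqI)
        (simp add: Delta_form[OF assms(1)] Delta_form[OF assms(2)] Delta_form[OF A_cochains_add[OF assms]]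
          form_add_left sum.distrib distrib_left)
  qed (simp add: Delta_off_degree)
qed

lemma Delta_scale:
  assumes "f \<in> A_cochains n"
  shows "Delta_cochain form \<nu> n (\<lambda>xs. scale r (f xs)) = (\<lambda>xs. scale r (Delta_cochain form \<nu> n f xs))"
proof (rule ext)
  fix xs
  show "Delta_cochain form \<nu> n (\<lambda>xs. scale r (f xs)) xs = scale r (Delta_cochain form \<nu> n f xs)"
  proof (cases "int (length xs) = n - 1")
    case True
    then show ?thesis
      by (intro form_eqI)
        (simp add: Delta_form[OF assms] Delta_form[OF A_cochains_scale[OF assms]] form_scale_left
          sum_distrib_left mult.left_commute)
  qed (simp add: Delta_off_degree)
qed

lemma Delta_zero [simp]: "Delta_cochain form \<nu> n 0 = 0"
  using Delta_add[of 0 n 0] by simp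

lemma Delta_diff:
  assumes "f \<in> A_cochains n" "g \<in> A_cochains n"
  shows "Delta_cochain form \<nu> n (f - g) = Delta_cochain form \<nu> n f - Delta_cochain form \<nu> n g"
  using Delta_add[OF A_cochains_diff[OF assms] assms(2)] by simp

lemma as_form_Delta:
  assumes f: "f \<in> A_cochains (int n)" and len: "length ys = n" "ys \<noteq> []"
  shows "as_form (Delta_cochain form \<nu> (int n) f) ys = cyclic_B \<nu> (as_form f) ys"
proof -
  obtain xs a where ys: "ys = xs @ [a]" using len(2) by (cases ys rule: rev_cases) auto
  have n: "length xs + 1 = n" using len by (simp add: ys)
  then have "int (length xs) = int n - 1" by linarith
  moreover have sign: "(- 1) powi (int i * (int n - 1)) * y = signed (i * (n + 1)) y" for i and y :: 'k
    by (auto simp: power_int_minus_left signed_def)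
  ultimately have "as_form (Delta_cochain form \<nu> (int n) f) ys
      = (\<Sum>i<n. signed (i * (n + 1)) (as_form f (bv_word \<nu> i a xs @ [1])))"
    using Delta_form[OF f, of xs a] by (simp add: as_form_def ys)
  also have "\<dots> = cyclic_B \<nu> (as_form f) ys"
    using sum_bv_word[OF n, where F = "\<lambda>zs. as_form f (zs @ [1])"] len by (simp add: cyclic_B_def ys)
  finally show ?thesis .
qed

lemma as_form_A_d:
  assumes len: "1 < length ys"
  shows "as_form (A_d f) ys = cyclic_d \<nu> (as_form f) ys"
proof -
  obtain xs a where ys: "ys = xs @ [a]" using len by (cases ys rule: rev_cases) auto
  define k where "k = length xs"
  have ne: "xs \<noteq> []" and k: "length xs = k" "0 < k" using len by (auto simp: ys k_def)
  have "as_form (A_d f) ys = form (f (tl xs)) (a * \<nu> (hd xs))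
      + (\<Sum>i=1..<k. signed i (form (f (merge i xs)) a))
      + signed k (form (f (butlast xs)) (last xs * a))"
    by (simp add: as_form_def ys A_d_apply[OF ne] form_add_left form_mult_left[of "hd xs"] form_sum_left
        form_signed_left form_assoc[of "f (butlast xs)"] k)
  also have "form (f (tl xs)) (a * \<nu> (hd xs)) = as_form f (cyclic_face \<nu> 0 ys)"
  proof -
    obtain x zs where xs: "xs = x # zs" using ne by (cases xs) auto
    show ?thesis using merge_last[of zs a "\<nu> x"] by (simp add: ys xs cyclic_face_def rotate_tw_def as_form_def)
  qed
  also have "(\<Sum>i=1..<k. signed i (form (f (merge i xs)) a)) = (\<Sum>i=1..<k. signed i (as_form f (cyclic_face \<nu> i ys)))"
    by (intro sum.cong refl) (simp add: k ys cyclic_face_def merge_append_left as_form_def)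
  also have "form (f (butlast xs)) (last xs * a) = as_form f (cyclic_face \<nu> k ys)"
  proof -
    obtain zs z where xs: "xs = zs @ [z]" using ne by (cases xs rule: rev_cases) auto
    show ?thesis using merge_last[of zs z a] k by (simp add: ys xs cyclic_face_def as_form_def)
  qed
  also have "as_form f (cyclic_face \<nu> 0 ys) + (\<Sum>i=1..<k. signed i (as_form f (cyclic_face \<nu> i ys)))
      + signed k (as_form f (cyclic_face \<nu> k ys)) = cyclic_d \<nu> (as_form f) ys"
  proof -
    have "{..<Suc k} = insert 0 (insert k {1..<k})" using k by auto
    then show ?thesis using k len by (simp add: cyclic_d_def ys) (simp add: signed_def add_ac)
  qed
  finally show ?thesis .
qed

text \<open>The action of \<open>\<nu>\<close> on cochains by conjugation; its fixed points are the invariant cochains.\<close>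

definition twist :: "('a list \<Rightarrow> 'a) \<Rightarrow> 'a list \<Rightarrow> 'a" where
  "twist f xs = inv \<nu> (f (map \<nu> xs))"

lemma nu_invariant_iff: "nu_invariant \<nu> f \<longleftrightarrow> twist f = f"
  by (auto simp: nu_invariant_def twist_def fun_eq_iff inv_nu_eq_iff)

lemma twist_in: "f \<in> A_cochains n \<Longrightarrow> twist f \<in> A_cochains n"
  by (auto simp: A_cochains_iff slot_additive_def twist_def nu_add nu_scale inv_nu_add inv_nu_scale)

lemma twist_add: "twist (f + g) = twist f + twist g"
  by (auto simp: twist_def inv_nu_add)

lemma twist_zero: "twist 0 = 0"
  by (auto simp: twist_def)

lemma twist_minus: "twist (- f) = - twist f"
  using twist_add[of f "- f"] by (simp add: twist_zero eq_neg_iff_add_eq_0 add.commute)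

lemma twist_sum: "twist (sum F I) = (\<Sum>i\<in>I. twist (F i))"
  by (rule ext) (simp add: twist_def sum_fun_apply inv_nu_sum)

lemma twist_scale: "twist (\<lambda>xs. scale r (f xs)) = (\<lambda>xs. scale r (twist f xs))"
  by (auto simp: twist_def inv_nu_scale)

lemma twist_A_d: "twist (A_d f) = A_d (twist f)"
proof (rule ext)
  fix xs
  have s: "inv \<nu> (signed k x) = signed k (inv \<nu> x)" for k x
    using inv_nu_add[of x "- x"] by (simp add: signed_def eq_neg_iff_add_eq_0 add.commute)
  show "twist (A_d f) xs = A_d (twist f) xs"
  proof (cases "xs = []")
    case True
    then show ?thesis by (simp add: twist_def hochschild_d_def)
  next
    case False
    then show ?thesis
      by (simp add: twist_def A_d_apply inv_nu_add inv_nu_mult inv_nu_sum s merge_map[of \<nu>, OF nu_mult]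
          hd_map last_map map_tl map_butlast)
  qed
qed

text \<open>The cyclic homotopy formula, read off from \<open>cyclic_homotopy\<close> by pairing with an arbitrary
  element of \<open>A\<close>.\<close>

lemma Delta_homotopy:
  assumes f: "f \<in> A_cochains n"
  shows "A_d (Delta_cochain form \<nu> n f) + Delta_cochain form \<nu> (n + 1) (A_d f) = twist f - f"
    (is "?L = ?R")
proof (cases "n < 0")
  case True
  then show ?thesis using A_cochains_negative[OF f] by (simp add: twist_zero)
next
  case False
  then obtain k where n: "n = int k" using nonneg_int_cases by (metis not_less)
  have L: "?L \<in> A_cochains n"
    using A_d_in[OF Delta_in[OF f]] Delta_in[OF A_d_in[OF f]] by (simp add: A_cochains_add)
  have R: "?R \<in> A_cochains n" using f by (intro A_cochains_diff twist_in)
  show ?thesis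
  proof (rule ext)
    fix xs
    show "?L xs = ?R xs"
    proof (cases "length xs = k")
      case False
      then have "int (length xs) \<noteq> n" by (simp add: n)
      then show ?thesis using A_cochains_degree[OF L] A_cochains_degree[OF R] by simp
    next
      case len: True
      show ?thesis
      proof (rule form_eqI)
        fix a
        let ?y = "xs @ [a]" and ?\<psi> = "as_form f"
        have 1: "form (A_d (Delta_cochain form \<nu> n f) xs) a = cyclic_d \<nu> (cyclic_B \<nu> ?\<psi>) ?y"
        proof (cases "k = 0")
          case True
          then have "Delta_cochain form \<nu> n f = 0"
            using A_cochains_negative[OF Delta_in[OF f]] n by simp
          then show ?thesis using len True by (simp add: cyclic_d_def)
        next
          case False
          have "form (A_d (Delta_cochain form \<nu> n f) xs) a
              = cyclic_d \<nu> (as_form (Delta_cochain form \<nu> n f)) ?y"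
            using as_form_A_d[of ?y "Delta_cochain form \<nu> n f"] len False by (simp add: as_form_def)
          also have "\<dots> = cyclic_d \<nu> (cyclic_B \<nu> ?\<psi>) ?y"
          proof -
            have "as_form (Delta_cochain form \<nu> n f) (cyclic_face \<nu> i ?y) = cyclic_B \<nu> ?\<psi> (cyclic_face \<nu> i ?y)"
              if "i < length ?y" for i
            proof -
              have "length (cyclic_face \<nu> i ?y) = k"
                using length_cyclic_face[OF that, of \<nu>] len False by simp
              then show ?thesis
                using as_form_Delta[of f k "cyclic_face \<nu> i ?y"] f False by (auto simp: n)
            qed
            then show ?thesis by (simp add: cyclic_d_def)
          qed
          finally show ?thesis .
        qed
        have "form (Delta_cochain form \<nu> (n + 1) (A_d f) xs) a = cyclic_B \<nu> (as_form (A_d f)) ?y"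
          using as_form_Delta[of "A_d f" "k + 1" ?y] A_d_in_nat[of f k] f len
          by (simp add: as_form_def n add.commute)
        also have "\<dots> = cyclic_B \<nu> (cyclic_d \<nu> ?\<psi>) ?y"
          unfolding cyclic_B_def
        proof (intro sum.cong refl)
          fix j
          have "1 < length ((rotate_tw \<nu> ^^ j) ?y @ [1])" by simp
          then show "signed ((j + 1) * (length ?y + 1)) (as_form (A_d f) ((rotate_tw \<nu> ^^ j) ?y @ [1]))
              = signed ((j + 1) * (length ?y + 1)) (cyclic_d \<nu> ?\<psi> ((rotate_tw \<nu> ^^ j) ?y @ [1]))"
            by (simp only: as_form_A_d)
        qed
        finally have "form (?L xs) a = ?\<psi> (map \<nu> ?y) - ?\<psi> ?y"
          using 1 cyclic_homotopy[of \<nu> ?y ?\<psi>, OF nu_mult] by (simp add: form_add_left)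
        also have "\<dots> = form (?R xs) a"
          by (simp add: as_form_def twist_def form_diff_left form_inv_nu)
        finally show "form (?L xs) a = form (?R xs) a" .
      qed
    qed
  qed
qed

end

section \<open>Averaging over the Nakayama automorphism\<close>

locale finite_order_nakayama_algebra = nakayama_algebra scale form \<nu>
  for scale :: "'k::field \<Rightarrow> 'a::{ring,monoid_mult} \<Rightarrow> 'a" and form :: "'a \<Rightarrow> 'a \<Rightarrow> 'k" and \<nu> +
  fixes r :: nat
  assumes power_nu: "\<nu> ^^ r = id"
    and order_nonzero: "of_nat r \<noteq> (0 :: 'k)"
begin

lemma twist_power: "(twist ^^ k) f xs = (inv \<nu> ^^ k) (f (map (\<nu> ^^ k) xs))"
proof (induction k arbitrary: xs)
  case (Suc k)
  have "map (\<nu> ^^ k) (map \<nu> xs) = map (\<lambda>a. \<nu> ((\<nu> ^^ k) a)) xs"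
    by (simp add: funpow_swap1)
  then show ?case
    by (simp only: funpow.simps(2) o_apply twist_def[of "(twist ^^ k) f"] Suc)
qed simp

lemma twist_power_order: "(twist ^^ r) f = f"
proof (rule ext)
  fix xs
  have "inv \<nu> ^^ r = inv (\<nu> ^^ r)" by (rule inv_fn[OF bij_nu, symmetric])
  then show "(twist ^^ r) f xs = f xs" by (simp add: twist_power power_nu)
qed

definition average :: "('a list \<Rightarrow> 'a) \<Rightarrow> 'a list \<Rightarrow> 'a" where
  "average f = (\<lambda>xs. scale (inverse (of_nat r)) ((\<Sum>k<r. (twist ^^ k) f) xs))"

lemma twist_power_in: "f \<in> A_cochains n \<Longrightarrow> (twist ^^ k) f \<in> A_cochains n"
  by (induction k) (simp_all add: twist_in)

lemma average_in: "f \<in> A_cochains n \<Longrightarrow> average f \<in> A_cochains n"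
  unfolding average_def by (intro A_cochains_scale A_cochains_sum twist_power_in)

text \<open>Applying \<open>T\<close> permutes the summands cyclically, since \<open>T\<^sup>r = 1\<close>.\<close>

lemma twist_average: "twist (average f) = average f"
proof -
  have "(\<Sum>k<r. (twist ^^ Suc k) f) = (\<Sum>k<r. (twist ^^ k) f)"
    using sum_lessThan_telescope[of "\<lambda>k. (twist ^^ k) f" r]
    by (simp only: sum_subtractf twist_power_order funpow_0) simp
  then have "twist (\<Sum>k<r. (twist ^^ k) f) = (\<Sum>k<r. (twist ^^ k) f)"
    by (simp add: twist_sum)
  then show ?thesis unfolding average_def twist_scale by simp
qed

lemma scale_order_inverse: "scale (inverse (of_nat r)) (\<Sum>k<r. x) = x"
proof -
  have "(\<Sum>k<n. x) = scale (of_nat n) x" for n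
    by (induction n) (simp_all add: scale_left_distrib add.commute)
  then show ?thesis using order_nonzero by simp
qed

lemma average_fixed: "twist f = f \<Longrightarrow> average f = f"
proof -
  assume f: "twist f = f"
  have "(twist ^^ k) f = f" for k by (induction k) (simp_all add: f)
  then show ?thesis by (simp add: average_def sum_fun_apply scale_order_inverse)
qed

lemma A_d_sum: "A_d (sum F I) = (\<Sum>i\<in>I. A_d (F i))"
proof (induction I rule: infinite_finite_induct)
  case (insert x I)
  have "A_d (sum F (insert x I)) = A_d (F x + sum F I)" by (simp only: sum.insert[OF insert(1,2)])
  then show ?case unfolding A_d_add insert(3) by (simp only: sum.insert[OF insert(1,2)])
next
  case (infinite I)
  show ?case unfolding sum.infinite[OF infinite] by (rule A_d_zero)
next
  case empty
  show ?case unfolding sum.empty by (rule A_d_zero)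
qed

lemma twist_power_A_d: "(twist ^^ k) (A_d f) = A_d ((twist ^^ k) f)"
  by (induction k) (simp_all add: twist_A_d)

lemma average_A_d: "average (A_d f) = A_d (average f)"
  unfolding average_def A_d_scale A_d_sum by (simp add: twist_power_A_d)

lemma twist_power_add: "(twist ^^ k) (f + g) = (twist ^^ k) f + (twist ^^ k) g"
  by (induction k) (simp_all only: funpow.simps id_apply o_apply twist_add)

lemma twist_power_scale: "(twist ^^ k) (\<lambda>xs. scale c (f xs)) = (\<lambda>xs. scale c ((twist ^^ k) f xs))"
  by (induction k) (simp_all add: twist_scale)

lemma average_add: "average (f + g) = average f + average g"
  by (rule ext) (simp add: average_def sum_fun_apply twist_power_add sum.distrib scale_right_distrib)

lemma average_scale: "average (\<lambda>xs. scale c (f xs)) = (\<lambda>xs. scale c (average f xs))"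
  by (rule ext)
     (simp add: average_def sum_fun_apply twist_power_scale scale_left_commute scale_sum_right[of c, symmetric])

text \<open>For a cocycle the homotopy formula reads \<open>d (\<Delta> f) = T f - f\<close>.\<close>

lemma twist_cohomologous:
  assumes f: "f \<in> A_cocycles n" shows "twist f - f \<in> A_coboundaries n"
proof -
  have "A_d (Delta_cochain form \<nu> n f) = twist f - f"
    using Delta_homotopy[of f n] f by (simp add: A_cocycles_iff)
  then show ?thesis
    using A_coboundariesI[OF Delta_in] f by (metis A_cocycles_iff)
qed

lemma average_cohomologous:
  assumes f: "f \<in> A_cocycles n" shows "average f \<in> A_class n f"
proof -
  have *: "(twist ^^ k) f \<in> A_cocycles n \<and> (twist ^^ k) f - f \<in> A_coboundaries n" for k
  proof (induction k)
    case (Suc k)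
    let ?g = "(twist ^^ k) f"
    have "twist ?g \<in> A_cocycles n"
      using Suc twist_in[of ?g n] twist_A_d[of ?g] by (simp add: A_cocycles_iff twist_zero)
    moreover have "(twist ?g - ?g) + (?g - f) \<in> A_coboundaries n"
      using Suc by (blast intro: A_coboundaries_add twist_cohomologous)
    then have "twist ?g - f \<in> A_coboundaries n" by simp
    ultimately show ?case by (simp only: funpow.simps(2) o_apply simp_thms)
  qed (use f in \<open>simp only: funpow_0 diff_self A_coboundaries_zero simp_thms\<close>)
  have "average f - f = (\<lambda>xs. scale (inverse (of_nat r)) ((\<Sum>k<r. (twist ^^ k) f - f) xs))"
    by (rule ext)
       (simp only: average_def sum_fun_apply fun_diff_def sum_subtractf scale_right_diff_distrib
         scale_order_inverse)
  also have "\<dots> \<in> A_coboundaries n"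
    using * by (intro A_coboundaries_scale A_coboundaries_sum) auto
  finally show ?thesis by (simp add: A_class_iff)
qed

lemma Delta_invariant_cocycle:
  assumes "f \<in> A_cocycles n" "twist f = f"
  shows "Delta_cochain form \<nu> n f \<in> A_cocycles (n - 1)"
  using Delta_homotopy[of f n] Delta_in[of f n] assms by (simp add: A_cocycles_iff)

text \<open>A cochain \<open>b\<close> with \<open>d b = f\<close> may be averaged without changing \<open>d b\<close>, because \<open>f\<close> is
  invariant.  For invariant \<open>b\<close> the homotopy formula gives \<open>\<Delta> (d b) = - d (\<Delta> b)\<close>.\<close>

lemma Delta_invariant_coboundary:
  assumes f: "f \<in> A_coboundaries n" and inv: "twist f = f"
  shows "Delta_cochain form \<nu> n f \<in> A_coboundaries (n - 1)"
proof -
  obtain b where b: "b \<in> A_cochains (n - 1)" "f = A_d b" using f by (rule A_coboundariesE)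
  let ?b = "average b"
  have eq: "f = A_d ?b" using average_fixed[OF inv] average_A_d[of b] b by simp
  have "A_d (Delta_cochain form \<nu> (n - 1) ?b) + Delta_cochain form \<nu> n f = 0"
    using Delta_homotopy[OF average_in[OF b(1)]] by (simp add: twist_average eq)
  then have "Delta_cochain form \<nu> n f = - A_d (Delta_cochain form \<nu> (n - 1) ?b)"
    by (simp add: eq_neg_iff_add_eq_0 add.commute)
  then show ?thesis
    using A_coboundaries_minus[OF A_coboundariesI[OF Delta_in[OF average_in[OF b(1)]]]] by simp
qed

lemma class_Delta:
  assumes f: "f \<in> A_cocycles n"
  shows "(\<Union>g\<in>{g\<in>A_class n f. nu_invariant \<nu> g}. A_class (n - 1) (Delta_cochain form \<nu> n g))
       = A_class (n - 1) (Delta_cochain form \<nu> n (average f))"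
proof (rule Union_constant[where x = "average f"])
  show "average f \<in> {g\<in>A_class n f. nu_invariant \<nu> g}"
    using average_cohomologous[OF f] twist_average by (simp add: nu_invariant_iff)
next
  fix g assume "g \<in> {g\<in>A_class n f. nu_invariant \<nu> g}"
  then have g: "g \<in> A_class n f" "twist g = g" by (simp_all add: nu_invariant_iff)
  let ?h = "g - average f"
  have "twist ?h = ?h"
    using twist_add[of g "- average f"] by (simp add: twist_minus twist_average g)
  moreover have "(g - f) - (average f - f) \<in> A_coboundaries n"
    using g(1) average_cohomologous[OF f] unfolding A_class_iff by (rule A_coboundaries_diff)
  ultimately have "Delta_cochain form \<nu> n ?h \<in> A_coboundaries (n - 1)"
    using Delta_invariant_coboundary by simp
  moreover have "g \<in> A_cochains n" "average f \<in> A_cochains n"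
    using A_class_cocycle[OF f g(1)] f average_in by (simp_all add: A_cocycles_iff)
  ultimately show "A_class (n - 1) (Delta_cochain form \<nu> n g) = A_class (n - 1) (Delta_cochain form \<nu> n (average f))"
    by (intro A_class_eqI) (simp add: Delta_diff)
qed

lemma well_formed_HH: "well_formed_data (HH_data scale form \<nu>)"
  unfolding well_formed_data_def
proof (intro conjI allI ballI)
  show "graded_module (HH_data scale form \<nu>)" by (rule graded_module_HH)
next
  fix n m c assume "c \<in> comp (HH_data scale form \<nu>) n"
  then have c: "c \<in> HH n" by simp
  show "graded_linear (HH_data scale form \<nu>) m (n + m) (\<lambda>d. cup (HH_data scale form \<nu>) n m c d)"
    using class_operation_linear_right[OF cup_bilinear cup_descends c] by simp
  show "graded_linear (HH_data scale form \<nu>) m (n + m - 1) (\<lambda>d. brk (HH_data scale form \<nu>) n m c d)"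
    using class_operation_linear_right[OF bracket_bilinear bracket_descends c] by simp
next
  fix n m d assume "d \<in> comp (HH_data scale form \<nu>) m"
  then have d: "d \<in> HH m" by simp
  show "graded_linear (HH_data scale form \<nu>) n (n + m) (\<lambda>c. cup (HH_data scale form \<nu>) n m c d)"
    using class_operation_linear_left[OF cup_bilinear cup_descends d] by simp
  show "graded_linear (HH_data scale form \<nu>) n (n + m - 1) (\<lambda>c. brk (HH_data scale form \<nu>) n m c d)"
    using class_operation_linear_left[OF bracket_bilinear bracket_descends d] by simp
next
  fix n
  show "graded_linear (HH_data scale form \<nu>) n (n - 1) (bvop (HH_data scale form \<nu>) n)"
  proof (rule graded_linear_HH_I[where t = "\<lambda>f. Delta_cochain form \<nu> n (average f)"])
    fix f assume f: "f \<in> A_cocycles n"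
    then have f': "f \<in> A_cochains n" by (simp add: A_cocycles_iff)
    show "bvop (HH_data scale form \<nu>) n (A_class n f) = A_class (n - 1) (Delta_cochain form \<nu> n (average f))"
      using class_Delta[OF f] by simp
    show "Delta_cochain form \<nu> n (average f) \<in> A_cocycles (n - 1)"
      using A_class_cocycle[OF f average_cohomologous[OF f]] twist_average
      by (rule Delta_invariant_cocycle)
    show "Delta_cochain form \<nu> n (average (\<lambda>xs. scale c (f xs)))
        - (\<lambda>xs. scale c (Delta_cochain form \<nu> n (average f) xs)) \<in> A_coboundaries (n - 1)" for c
      by (simp add: average_scale Delta_scale[OF average_in[OF f']])
    fix g assume "g \<in> A_cocycles n"
    then have g': "g \<in> A_cochains n" by (simp add: A_cocycles_iff)
    show "Delta_cochain form \<nu> n (average (f + g))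
        - (Delta_cochain form \<nu> n (average f) + Delta_cochain form \<nu> n (average g)) \<in> A_coboundaries (n - 1)"
      by (simp add: average_add Delta_add[OF average_in[OF f'] average_in[OF g']])
  qed
qed

end

section \<open>Transport of structure\<close>

text \<open>A structure \<open>Y\<close> obtained from \<open>X\<close> by renaming elements.  One map \<open>\<psi>\<close> serves all degrees
  and all arguments, so degrees need not be matched when formulas are rewritten.  Only for the BV
  operator is the argument restricted: the value of \<open>Delta_cochain\<close> at functions that are not
  cochains is arbitrary.\<close>

locale bv_transport =
  fixes X :: "('k::field, 'h) bv_data" and Y :: "('k, 'g) bv_data" and \<psi> :: "'h \<Rightarrow> 'g"
  assumes inj: "inj \<psi>"
    and comp: "comp Y n = \<psi> ` comp X n"
    and hadd: "hadd Y n (\<psi> f) (\<psi> g) = \<psi> (hadd X n f g)"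
    and hzero: "hzero Y n = \<psi> (hzero X n)"
    and hscale: "hscale Y n c (\<psi> f) = \<psi> (hscale X n c f)"
    and cup: "cup Y n m (\<psi> f) (\<psi> g) = \<psi> (cup X n m f g)"
    and brk: "brk Y n m (\<psi> f) (\<psi> g) = \<psi> (brk X n m f g)"
    and bvop: "f \<in> comp X n \<Longrightarrow> bvop Y n (\<psi> f) = \<psi> (bvop X n f)"
    and well_formed: "well_formed_data X"
begin

lemma graded_module_transport: "graded_module Y \<longleftrightarrow> graded_module X"
  by (simp add: graded_module_def comp hadd hzero hscale inj_eq[OF inj] inj_image_mem_iff[OF inj])

lemma graded_linear_transport:
  assumes "\<And>f. f \<in> comp X n \<Longrightarrow> T' (\<psi> f) = \<psi> (T f)"
    and "graded_linear X n p T"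
  shows "graded_linear Y n p T'"
proof -
  have "graded_module X" using well_formed by (simp add: well_formed_data_def)
  then have "hadd X n f g \<in> comp X n" "hscale X n c f \<in> comp X n"
    if "f \<in> comp X n" "g \<in> comp X n" for f g c
    using that by (auto simp: graded_module_def)
  then show ?thesis
    using assms by (auto simp: graded_linear_def comp hadd hscale)
qed

lemma well_formed_transport: "well_formed_data Y"
  using well_formed
  by (auto simp: well_formed_data_def graded_module_transport comp cup brk bvop
      intro: graded_linear_transport)

lemma bv_algebra_transport: "bv_algebra Y \<longleftrightarrow> bv_algebra X"
proof -
  have cup_closed: "cup X n m f g \<in> comp X (n + m)" if "f \<in> comp X n" "g \<in> comp X m" for n m f g
    using well_formed that by (auto simp: well_formed_data_def graded_linear_def)
  have bvop_closed: "bvop X n f \<in> comp X (n - 1)" if "f \<in> comp X n" for n f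
    using well_formed that by (auto simp: well_formed_data_def graded_linear_def)
  have "gerstenhaber_algebra Y \<longleftrightarrow> gerstenhaber_algebra X"
    by (simp only: gerstenhaber_algebra_def well_formed well_formed_transport comp cup brk
        hadd hscale inj_eq[OF inj] ball_simps)
  moreover have "(\<forall>n. \<forall>f\<in>comp Y n. bvop Y (n - 1) (bvop Y n f) = hzero Y (n - 2)) \<longleftrightarrow>
      (\<forall>n. \<forall>f\<in>comp X n. bvop X (n - 1) (bvop X n f) = hzero X (n - 2))"
    unfolding comp ball_simps
    by (intro all_cong1 ball_cong refl) (simp only: bvop bvop_closed hzero inj_eq[OF inj])
  moreover have "(\<forall>n m. \<forall>f\<in>comp Y n. \<forall>g\<in>comp Y m. brk Y n m f g = 
        hscale Y (n + m - 1) ((-1) powi n)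
            (hadd Y (n + m - 1) (bvop Y (n + m) (cup Y n m f g))
              (hadd Y (n + m - 1)
                (hscale Y (n + m - 1) (-1) (cup Y (n - 1) m (bvop Y n f) g))
                (hscale Y (n + m - 1) (- ((-1) powi n)) (cup Y n (m - 1) f (bvop Y m g)))))) \<longleftrightarrow>
      (\<forall>n m. \<forall>f\<in>comp X n. \<forall>g\<in>comp X m. brk X n m f g = 
        hscale X (n + m - 1) ((-1) powi n)
            (hadd X (n + m - 1) (bvop X (n + m) (cup X n m f g))
              (hadd X (n + m - 1)
                (hscale X (n + m - 1) (-1) (cup X (n - 1) m (bvop X n f) g))
                (hscale X (n + m - 1) (- ((-1) powi n)) (cup X n (m - 1) f (bvop X m g))))))"
    unfolding comp ball_simps
    by (intro all_cong1 ball_cong refl)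
      (simp only: bvop cup cup_closed hadd hscale brk inj_eq[OF inj])
  ultimately show ?thesis
    by (simp only: bv_algebra_def)
qed

lemma bv_isomorphism_transport: "bv_isomorphism X Y (\<lambda>n. \<psi>)"
  using inj_on_subset[OF inj]
  by (auto simp: bv_isomorphism_def bij_betw_def comp hadd hscale cup brk bvop)

end

section \<open>Comparison with the twisted dual\<close>

context nakayama_algebra
begin

abbreviation D_bimodule :: "('k, 'a, 'a \<Rightarrow> 'k) bimodule" where
  "D_bimodule \<equiv> twisted_dual scale \<nu>"

text \<open>Composition with \<open>Z\<close>, the comparison map on cochains.\<close>

abbreviation Zc :: "('a list \<Rightarrow> 'a) \<Rightarrow> 'a list \<Rightarrow> 'a \<Rightarrow> 'k" where
  "Zc f \<equiv> Z \<circ> f"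

lemma inj_Zc: "inj Zc"
  using inj_Z by (simp add: fun.inj_map)

lemma Z_add: "Z (x + y) = Z x + Z y"
  by (auto simp: frob_iso_def form_add_left)

lemma Z_zero [simp]: "Z 0 = 0"
  by (auto simp: frob_iso_def)

lemma Z_scale: "Z (scale c x) = (\<lambda>a. c * Z x a)"
  by (auto simp: frob_iso_def form_scale_left)

lemma Z_diff: "Z (x - y) = Z x - Z y"
  by (auto simp: frob_iso_def form_diff_left)

lemma Z_sum: "Z (sum F I) = (\<Sum>i\<in>I. Z (F i))"
  by (rule ext) (simp add: frob_iso_def form_sum_left sum_fun_apply)

lemma Zc_add: "Zc (f + g) = Zc f + Zc g"
  by (rule ext) (simp add: Z_add)

lemma Zc_diff: "Zc (f - g) = Zc f - Zc g"
  by (rule ext) (simp add: Z_diff)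

lemma Zc_in_iff: "Zc f \<in> cochains scale D_bimodule n \<longleftrightarrow> f \<in> A_cochains n"
proof -
  have "Z x = 0 \<longleftrightarrow> x = 0" "Z x = Z y + Z z \<longleftrightarrow> x = y + z"
    "Z x = (\<lambda>a. c * Z y a) \<longleftrightarrow> x = scale c y" for x y z c
    using inj_eq[OF inj_Z, of x 0] inj_eq[OF inj_Z, of x "y + z"] inj_eq[OF inj_Z, of x "scale c y"]
    by (simp_all add: Z_add Z_scale)
  then show ?thesis
    by (simp add: cochains_def twisted_dual_def regular_bimodule_def linear_Z)
qed

text \<open>Values of cochains in the twisted dual are linear functionals, hence in the image of \<open>Z\<close>.\<close>

lemma D_cochains_eq: "cochains scale D_bimodule n = Zc ` A_cochains n"
proof
  show "cochains scale D_bimodule n \<subseteq> Zc ` A_cochains n"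
  proof
    fix h assume h: "h \<in> cochains scale D_bimodule n"
    then have "Vector_Spaces.linear scale (*) (h xs)" for xs
      by (simp add: cochains_def twisted_dual_def)
    then have "\<exists>a. Z a = h xs" for xs by (metis Z_surjective)
    then obtain f where "\<And>xs. Z (f xs) = h xs" by metis
    then have "h = Zc f" by (simp add: fun_eq_iff)
    then show "h \<in> Zc ` A_cochains n" using h Zc_in_iff by blast
  qed
qed (use Zc_in_iff in blast)

lemma D_d_Zc: "hochschild_d D_bimodule (Zc f) = Zc (A_d f)"
proof (rule ext)+
  fix xs a
  show "hochschild_d D_bimodule (Zc f) xs a = Zc (A_d f) xs a"
    by (simp add: hochschild_d_def twisted_dual_def regular_bimodule_def frob_iso_def form_add_left
        form_sum_left form_scale_left form_mult_left[of "hd xs"] form_assoc[of "f (butlast xs)"]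
        sum_fun_apply)
qed

lemma D_coboundaries_eq: "coboundaries scale D_bimodule n = Zc ` A_coboundaries n"
  unfolding coboundaries_def D_cochains_eq by (simp add: image_image D_d_Zc)

lemma D_cocycles_eq: "cocycles scale D_bimodule n = Zc ` A_cocycles n"
proof -
  have "Zc g = 0 \<longleftrightarrow> g = 0" for g
    using inj_eq[OF inj_Zc, of g 0] by (simp add: fun_eq_iff)
  then show ?thesis
    unfolding cocycles_def D_cochains_eq by (auto simp: D_d_Zc)
qed

lemma D_class_Zc: "coh_class scale D_bimodule n (Zc f) = Zc ` A_class n f"
proof -
  have "g - Zc f \<in> Zc ` A_coboundaries n \<longleftrightarrow> g \<in> Zc ` A_class n f" for g
  proof
    assume "g - Zc f \<in> Zc ` A_coboundaries n"
    then obtain b where b: "b \<in> A_coboundaries n" "g - Zc f = Zc b" by blast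
    then have "g = Zc (b + f)" unfolding Zc_add by (simp add: algebra_simps)
    then show "g \<in> Zc ` A_class n f" using b(1) by (auto simp: A_class_iff)
  next
    assume "g \<in> Zc ` A_class n f"
    then obtain h where "g = Zc h" "h - f \<in> A_coboundaries n" by (auto simp: A_class_iff)
    then show "g - Zc f \<in> Zc ` A_coboundaries n" by (metis Zc_diff imageI)
  qed
  then show ?thesis by (auto simp: coh_class_def D_coboundaries_eq)
qed

lemma D_cohomology_eq: "cohomology scale D_bimodule n = (`) Zc ` HH n"
  unfolding cohomology_def D_cocycles_eq by (simp add: image_image D_class_Zc)

lemma D_cup_Zc: "cup_cochain (twisted_dual_mult form) n m (Zc f) (Zc g) = Zc (cup_cochain (*) n m f g)"
  by (rule ext) (simp add: cup_cochain_def twisted_dual_mult_def)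

lemma D_circ_Zc: "circ_cochain D_bimodule n m (Zc f) g = Zc (circ_cochain (regular_bimodule scale) n m f g)"
  by (rule ext) (simp add: circ_cochain_def twisted_dual_def regular_bimodule_def Z_sum Z_scale)

lemma D_bracket_Zc: "bracket_cochain D_bimodule (inv Z) n m (Zc f) (Zc g) = Zc (A_bracket n m f g)"
proof -
  have inv: "inv Z \<circ> Zc f = f" for f by (simp add: fun_eq_iff)
  show ?thesis
    unfolding bracket_cochain_def D_circ_Zc inv
    by (simp add: fun_eq_iff twisted_dual_def regular_bimodule_def Z_diff Z_scale)
qed

lemma D_B_Zc:
  assumes "f \<in> A_cochains n"
  shows "B_cochain \<nu> n (Zc f) = Zc (Delta_cochain form \<nu> n f)"
proof (rule ext)+
  fix xs a
  show "B_cochain \<nu> n (Zc f) xs a = Zc (Delta_cochain form \<nu> n f) xs a"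
    using Delta_form[OF assms, of xs a]
    by (cases "int (length xs) = n - 1")
       (simp_all add: B_cochain_def frob_iso_def Delta_off_degree)
qed

text \<open>The form is \<open>\<nu>\<close>-invariant, so the two notions of invariance correspond.\<close>

lemma D_invariant_Zc: "nu_invariant_dual \<nu> (Zc f) \<longleftrightarrow> nu_invariant \<nu> f"
proof -
  have "(\<forall>c. form x (\<nu> c) = form y c) \<longleftrightarrow> x = \<nu> y" for x y
    using form_nu_nu by (metis form_eqI nu_inv(1))
  then show ?thesis
    by (simp add: nu_invariant_dual_def nu_invariant_def frob_iso_def)
qed

lemma D_data_simps:
  "comp (H_twisted_dual_data scale form \<nu>) = cohomology scale D_bimodule"
  "hadd (H_twisted_dual_data scale form \<nu>) n c d = (\<Union>f\<in>c. \<Union>g\<in>d. coh_class scale D_bimodule n (f + g))"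
  "hzero (H_twisted_dual_data scale form \<nu>) n = coh_class scale D_bimodule n 0"
  "hscale (H_twisted_dual_data scale form \<nu>) n r c
     = (\<Union>f\<in>c. coh_class scale D_bimodule n (\<lambda>xs a. r * f xs a))"
  "cup (H_twisted_dual_data scale form \<nu>) n m c d
     = (\<Union>f\<in>c. \<Union>g\<in>d. coh_class scale D_bimodule (n + m) (cup_cochain (twisted_dual_mult form) n m f g))"
  "brk (H_twisted_dual_data scale form \<nu>) n m c d
     = (\<Union>f\<in>c. \<Union>g\<in>d. coh_class scale D_bimodule (n + m - 1) (bracket_cochain D_bimodule (inv Z) n m f g))"
  "bvop (H_twisted_dual_data scale form \<nu>) n c
     = (\<Union>f\<in>{f\<in>c. nu_invariant_dual \<nu> f}. coh_class scale D_bimodule (n - 1) (B_cochain \<nu> n f))"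
  by (simp_all add: H_twisted_dual_data_def Let_def) (simp add: twisted_dual_def)

end

context finite_order_nakayama_algebra
begin

lemma transport_HH: "bv_transport (HH_data scale form \<nu>) (H_twisted_dual_data scale form \<nu>) ((`) Zc)"
proof (unfold_locales)
  show "inj ((`) Zc)" by (rule injI) (simp add: inj_image_eq_iff[OF inj_Zc])
next
  fix n
  show "comp (H_twisted_dual_data scale form \<nu>) n = (`) Zc ` comp (HH_data scale form \<nu>) n"
    by (simp add: D_data_simps D_cohomology_eq)
  have "Zc 0 = 0" by (simp add: fun_eq_iff)
  then show "hzero (H_twisted_dual_data scale form \<nu>) n = Zc ` hzero (HH_data scale form \<nu>) n"
    using D_class_Zc[of n 0] by (simp add: D_data_simps)
next
  fix n and c d :: "('a list \<Rightarrow> 'a) set"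
  show "hadd (H_twisted_dual_data scale form \<nu>) n (Zc ` c) (Zc ` d) = Zc ` hadd (HH_data scale form \<nu>) n c d"
    by (simp add: D_data_simps class_add_def Zc_add[symmetric] D_class_Zc image_UN)
next
  fix n s and c :: "('a list \<Rightarrow> 'a) set"
  have "(\<lambda>xs a. s * Zc f xs a) = Zc (\<lambda>xs. scale s (f xs))" for f
    by (simp add: fun_eq_iff Z_scale)
  then show "hscale (H_twisted_dual_data scale form \<nu>) n s (Zc ` c) = Zc ` hscale (HH_data scale form \<nu>) n s c"
    by (simp add: D_data_simps class_scale_def D_class_Zc image_UN del: o_apply)
next
  fix n m and c d :: "('a list \<Rightarrow> 'a) set"
  show "cup (H_twisted_dual_data scale form \<nu>) n m (Zc ` c) (Zc ` d) = Zc ` cup (HH_data scale form \<nu>) n m c d"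
    by (simp add: D_data_simps D_cup_Zc D_class_Zc image_UN)
  show "brk (H_twisted_dual_data scale form \<nu>) n m (Zc ` c) (Zc ` d) = Zc ` brk (HH_data scale form \<nu>) n m c d"
    by (simp add: D_data_simps D_bracket_Zc D_class_Zc image_UN)
next
  fix n c assume "c \<in> comp (HH_data scale form \<nu>) n"
  then have "c \<in> HH n" by simp
  then obtain g where "g \<in> A_cocycles n" "c = A_class n g" by (rule HH_E)
  then have c: "f \<in> A_cochains n" if "f \<in> c" for f
    using A_class_cocycle[of g n f] that by (simp add: A_cocycles_iff)
  have "{f \<in> Zc ` c. nu_invariant_dual \<nu> f} = Zc ` {f \<in> c. nu_invariant \<nu> f}"
    by (auto simp: D_invariant_Zc)
  then have "bvop (H_twisted_dual_data scale form \<nu>) n (Zc ` c)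
      = (\<Union>f\<in>{f\<in>c. nu_invariant \<nu> f}. coh_class scale D_bimodule (n - 1) (B_cochain \<nu> n (Zc f)))"
    by (simp add: D_data_simps)
  also have "\<dots> = (\<Union>f\<in>{f\<in>c. nu_invariant \<nu> f}. Zc ` A_class (n - 1) (Delta_cochain form \<nu> n f))"
    by (intro SUP_cong refl) (simp add: c D_B_Zc D_class_Zc)
  finally show "bvop (H_twisted_dual_data scale form \<nu>) n (Zc ` c) = Zc ` bvop (HH_data scale form \<nu>) n c"
    by (simp add: image_UN)
qed (rule well_formed_HH)

end

theorem corollary4p5:
  fixes scale :: "'k::alg_closed_field \<Rightarrow> 'a::{ring,monoid_mult} \<Rightarrow> 'a"
    and form :: "'a \<Rightarrow> 'a \<Rightarrow> 'k"
    and \<nu> :: "'a \<Rightarrow> 'a"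
  assumes "frobenius_algebra scale form"
    and "nakayama_automorphism scale form \<nu>"
    and "has_finite_order \<nu>"
    and "\<not> CHAR('k) dvd map_order \<nu>"
  shows "well_formed_data (HH_data scale form \<nu>) \<and>
    well_formed_data (H_twisted_dual_data scale form \<nu>) \<and>
    (bv_algebra (HH_data scale form \<nu>) \<longleftrightarrow> bv_algebra (H_twisted_dual_data scale form \<nu>)) \<and>
    (\<exists>\<phi>. bv_isomorphism (HH_data scale form \<nu>) (H_twisted_dual_data scale form \<nu>) \<phi>)"
proof -
  interpret frobenius_algebra scale form by (rule assms(1))
  have "map_order \<nu> > 0 \<and> \<nu> ^^ map_order \<nu> = id"
    unfolding map_order_def by (rule LeastI_ex) (use assms(3) in \<open>simp add: has_finite_order_def\<close>)
  then interpret finite_order_nakayama_algebra scale form \<nu> "map_order \<nu>"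
    using assms(2,4) by unfold_locales (simp_all add: of_nat_eq_0_iff_char_dvd)
  interpret bv_transport "HH_data scale form \<nu>" "H_twisted_dual_data scale form \<nu>" "(`) Zc"
    by (rule transport_HH)
  show ?thesis
    by (intro conjI well_formed_HH well_formed_transport bv_algebra_transport[symmetric]
        exI[of _ "\<lambda>n. (`) Zc"] bv_isomorphism_transport)
qed

end
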